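(* For all $P,Q\in\Gamma(\wedge^{\ge1}E)$, $$\langle P,Q\rangle=[P,Q]_{KW},$$ where the left-hand side is the extension of the bilinear form to $\Gamma(\wedge^\bullet E)$ and, on the right-hand side, $P$ and $Q$ are regarded as elements of $\mathcal{C}(E)$.
   Context: Setting. $E\to M$ is a smooth vector bundle over a smooth manifold, equipped with a fibrewise non-degenerate symmetric bilinear form $\langle\cdot,\cdot\rangle$. $\Gamma(\wedge^nE)$ is the space of sections of $\wedge^n E$, with $\Gamma(\wedge^0E)=C^\infty(M)$ and $\Gamma(\wedge^nE)=\{0\}$ for $n<0$; $\Gamma(\wedge^\bullet E)=\oplus_{n\ge0}\Gamma(\wedge^nE)$ and $\Gamma(\wedge^{\ge1}E)=\oplus_{n\ge1}\Gamma(\wedge^nE)$. A hat denotes omission. Multilinear means $\mathbb{R}$-multilinear. Extended bilinear form. $\langle\cdot,\cdot\rangle$ is extended bilinearly to $\Gamma(\wedge^\bullet E)$ as a degree $-2$ operation ($\langle P,Q\rangle\in\Gamma(\wedge^{p+q-2}E)$ for $P\in\Gamma(\wedge^pE)$, $Q\in\Gamma(\wedge^qE)$, $p,q\ge1$) satisfying, for $R\in\Gamma(\wedge^\bullet E)$, $f\in C^\infty(M)$: $\langle P,Q\rangle=-(-1)^{pq}\langle Q,P\rangle$; $\langle f,R\rangle=\langle R,f\rangle=0$; $\langle P,\langle Q,R\rangle\rangle=\langle\langle P,Q\rangle,R\rangle+(-1)^{pq}\langle Q,\langle P,R\rangle\rangle$; $\langle P,Q\wedge R\rangle=\langle P,Q\rangle\wedge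 R+(-1)^{pq}Q\wedge\langle P,R\rangle$. Pre-multi-Courant structures. An $n$-ary pre-Courant structure ($n\ge1$) is a multilinear map $C:\Gamma(E)^{\times n}\to\Gamma(E)$ for which there is a map (the symbol) $\sigma_C:\Gamma(E)^{\times(n-1)}\to\mathfrak{X}(M)$ such that for all sections (a) $\sigma_C(e_1,\dots,e_{n-1})\cdot\langle e,e'\rangle=\langle C(e_1,\dots,e_{n-1},e),e'\rangle+\langle e,C(e_1,\dots,e_{n-1},e')\rangle$; (b) for $n\ge2$, $1\le i\le n-1$: $\langle C(e_1,\dots,e_i,e_{i+1},\dots,e_n)+C(e_1,\dots,e_{i+1},e_i,\dots,e_n),e\rangle=\sigma_C(e_1,\dots,\widehat{e_i},\widehat{e_{i+1}},\dots,e_n,e)\cdot\langle e_i,e_{i+1}\rangle$. The symbol is uniquely determined by $C$. $\mathcal{C}^{n+1}(E)$ is the space of $n$-ary pre-Courant structures, $\mathcal{C}^1(E)=\Gamma(E)$, $\mathcal{C}^0(E)=C^\infty(M)$ (with vanishing symbols), $\mathcal{C}(E)=\oplus_{n\ge0}\mathcal{C}^n(E)$. For $e\in\Gamma(E)$: $(\imath_eC)(e_1,\dots)=C(e,e_1,\dots)$ with symbol $\sigma_C(e,\dots)$, $\imath_ee_1=\langle e,e_1\rangle$, $\imath_ef=0$. Product on $\mathcal{C}(E)$. The associative graded commutative product $\wedge$ of degree $0$ is determined by $f\wedge g=fg$, $f\wedge e=fe=e\wedge f$ for $f,g\in C^\infty(M)$, $e\in\Gamma(E)$, and $\imath_e(C_1\wedge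 C_2)=\imath_eC_1\wedge C_2+(-1)^nC_1\wedge\imath_eC_2$ for $C_1\in\mathcal{C}^n(E)$. A section $P=e_1\wedge\dots\wedge e_p$ of $\wedge^pE$ is regarded as the element $e_1\wedge\dots\wedge e_p\in\mathcal{C}^p(E)$ (product in $\mathcal{C}(E)$ of elements $e_i\in\mathcal{C}^1(E)$); equivalently $P(e'_1,\dots,e'_{p-1})=\langle e'_{p-1},\dots,\langle e'_2,\langle e'_1,P\rangle\rangle\dots\rangle$. Bracket on $\mathcal{C}(E)$. $[\cdot,\cdot]_{KW}:\mathcal{C}^n(E)\times\mathcal{C}^m(E)\to\mathcal{C}^{n+m-2}(E)$ is the graded Lie bracket of degree $-2$ uniquely determined by $[f,g]_{KW}=0$, $[f,e]_{KW}=0=[e,f]_{KW}$, $[e,e']_{KW}=\langle e,e'\rangle$, $[f,D]_{KW}=\sigma_D\cdot f=-[D,f]_{KW}$ for $D\in\mathcal{C}^2(E)$, $[e,C_1]_{KW}=(-1)^{n+1}[C_1,e]_{KW}=\imath_eC_1$ for $C_1\in\mathcal{C}^n(E)$, and recursively $\imath_e[C_1,C_2]_{KW}=[[e,C_1]_{KW},C_2]_{KW}+(-1)^n[C_1,[e,C_2]_{KW}]_{KW}$. It is known that $(\mathcal{C}(E),\wedge,[\cdot,\cdot]_{KW})$ is a graded Poisson algebra of degree $-2$; in particular $[C_1,C_2\wedge C_3]_{KW}=[C_1,C_2]_{KW}\wedge C_3+(-1)^{nm}C_2\wedge[C_1,C_3]_{KW}$ for $C_1\in\mathcal{C}^n(E)$,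 $C_2\in\mathcal{C}^m(E)$. *)

theory Defs
  imports "HOL-Analysis.Analysis" "HOL-Library.Function_Algebras"
begin

section \<open>Smooth functions of several real variables\<close>

text \<open>
  Points of $d$-dimensional coordinate space are functions \<open>nat \<Rightarrow> real\<close> vanishing at all indices
  \<open>\<ge> d\<close> (the library's \<^const>\<open>Euclidean_space\<close>); this also covers $d = 0$.
\<close>

definition partial :: "nat \<Rightarrow> ((nat \<Rightarrow> real) \<Rightarrow> real) \<Rightarrow> (nat \<Rightarrow> real) \<Rightarrow> real" where
  "partial i f = (\<lambda>x. deriv (\<lambda>t. f (x(i := t))) (x i))"

text \<open>All iterated partial derivatives exist and are continuous on the open set \<open>S\<close>.\<close>

definition smooth_coord :: "nat \<Rightarrow> (nat \<Rightarrow> real) set \<Rightarrow> ((nat \<Rightarrow> real) \<Rightarrow> real) \<Rightarrow> bool" where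
  "smooth_coord d S f \<longleftrightarrow>
     (\<forall>is. set is \<subseteq> {..<d} \<longrightarrow>
        continuous_on S (foldr partial is f) \<and>
        (\<forall>i<d. \<forall>x\<in>S. (\<lambda>t. foldr partial is f (x(i := t))) differentiable (at (x i))))"


section \<open>Vector bundles with a fibrewise bilinear form\<close>

text \<open>
  The base manifold is the type \<open>'m\<close> together with an atlas. The fibres \<open>fib E x\<close> are linear
  subspaces of an arbitrary real vector space \<open>'v\<close>, which carries no topology and only serves as a
  container: the bundle structure is entirely given by the local trivialisations
  \<open>(U, \<psi>)\<close>, where \<open>\<psi> x\<close> maps \<open>fib E x\<close> isomorphically to coordinate space for \<open>x \<in> U\<close>. Every vector
  bundle is of this form, for instance with \<open>'v\<close> the direct sum of all its fibres.
\<close>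

record ('m, 'v) vbundle =
  dim_base :: nat
  atlas :: "('m set \<times> ('m \<Rightarrow> nat \<Rightarrow> real)) set"
  fib_dim :: nat
  fib :: "'m \<Rightarrow> 'v set"
  trivs :: "('m set \<times> ('m \<Rightarrow> 'v \<Rightarrow> nat \<Rightarrow> real)) set"
  form :: "'m \<Rightarrow> 'v \<Rightarrow> 'v \<Rightarrow> real"

definition smooth_on :: "('m, 'v, 'z) vbundle_scheme \<Rightarrow> 'm set \<Rightarrow> ('m \<Rightarrow> real) \<Rightarrow> bool" where
  "smooth_on E W f \<longleftrightarrow>
     (\<forall>(U, \<phi>)\<in>atlas E. smooth_coord (dim_base E) (\<phi> ` (U \<inter> W)) (f \<circ> inv_into U \<phi>))"

text \<open>
  In \<open>smooth_manifold\<close>, smoothness of all components of all charts amounts to smoothness of all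
  transition maps.
\<close>

definition smooth_manifold ::
    "('m::{t2_space, second_countable_topology}, 'v, 'z) vbundle_scheme \<Rightarrow> bool" where
  "smooth_manifold E \<longleftrightarrow>
     (\<Union>(U, \<phi>)\<in>atlas E. U) = UNIV \<and>
     (\<forall>(U, \<phi>)\<in>atlas E.
        open U \<and>
        openin (Euclidean_space (dim_base E)) (\<phi> ` U) \<and>
        homeomorphic_map (top_of_set U)
          (subtopology (Euclidean_space (dim_base E)) (\<phi> ` U)) \<phi>) \<and>
     (\<forall>(U, \<phi>)\<in>atlas E. \<forall>i<dim_base E. smooth_on E U (\<lambda>x. \<phi> x i))"

definition vector_bundle ::
    "('m::{t2_space, second_countable_topology}, 'v::real_vector, 'z) vbundle_scheme \<Rightarrow> bool" where
  "vector_bundle E \<longleftrightarrow>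
     smooth_manifold E \<and>
     (\<forall>x. subspace (fib E x)) \<and>
     (\<Union>(U, \<psi>)\<in>trivs E. U) = UNIV \<and>
     (\<forall>(U, \<psi>)\<in>trivs E.
        open U \<and>
        (\<forall>x\<in>U.
           bij_betw (\<psi> x) (fib E x) (topspace (Euclidean_space (fib_dim E))) \<and>
           (\<forall>u\<in>fib E x. \<forall>v\<in>fib E x. \<forall>c i. \<psi> x (c *\<^sub>R u + v) i = c * \<psi> x u i + \<psi> x v i))) \<and>
     (\<forall>(U, \<psi>)\<in>trivs E. \<forall>(U', \<psi>')\<in>trivs E. \<exists>h.
        (\<forall>i<fib_dim E. \<forall>j<fib_dim E. smooth_on E (U \<inter> U') (h i j)) \<and>
        (\<forall>x\<in>U \<inter> U'. \<forall>v\<in>fib E x. \<forall>i<fib_dim E. \<psi>' x v i = (\<Sum>j<fib_dim E. h i j x * \<psi> x v j)))"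

definition metric_bundle ::
    "('m::{t2_space, second_countable_topology}, 'v::real_vector, 'z) vbundle_scheme \<Rightarrow> bool" where
  "metric_bundle E \<longleftrightarrow>
     vector_bundle E \<and>
     (\<forall>x. \<forall>u\<in>fib E x. \<forall>v\<in>fib E x. form E x u v = form E x v u) \<and>
     (\<forall>x. \<forall>u\<in>fib E x. \<forall>v\<in>fib E x. \<forall>w\<in>fib E x. \<forall>c.
        form E x (c *\<^sub>R u + v) w = c * form E x u w + form E x v w) \<and>
     (\<forall>x. \<forall>u\<in>fib E x. (\<forall>v\<in>fib E x. form E x u v = 0) \<longrightarrow> u = 0) \<and>
     (\<forall>(U, \<psi>)\<in>trivs E. \<exists>g.
        (\<forall>i<fib_dim E. \<forall>j<fib_dim E. smooth_on E U (g i j)) \<and>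
        (\<forall>x\<in>U. \<forall>u\<in>fib E x. \<forall>v\<in>fib E x.
           form E x u v = (\<Sum>i<fib_dim E. \<Sum>j<fib_dim E. g i j x * \<psi> x u i * \<psi> x v j)))"

definition smooth_funs :: "('m, 'v, 'z) vbundle_scheme \<Rightarrow> ('m \<Rightarrow> real) set" where
  "smooth_funs E = {f. smooth_on E UNIV f}"

definition sections :: "('m, 'v, 'z) vbundle_scheme \<Rightarrow> ('m \<Rightarrow> 'v) set" where
  "sections E = {s. (\<forall>x. s x \<in> fib E x) \<and>
     (\<forall>(U, \<psi>)\<in>trivs E. \<forall>i<fib_dim E. smooth_on E U (\<lambda>x. \<psi> x (s x) i))}"

definition pairing ::
    "('m, 'v, 'z) vbundle_scheme \<Rightarrow> ('m \<Rightarrow> 'v) \<Rightarrow> ('m \<Rightarrow> 'v) \<Rightarrow> 'm \<Rightarrow> real" where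
  "pairing E e e' = (\<lambda>x. form E x (e x) (e' x))"

text \<open>Vector fields, as derivations of the algebra of smooth functions.\<close>

definition vector_field ::
    "('m, 'v, 'z) vbundle_scheme \<Rightarrow> (('m \<Rightarrow> real) \<Rightarrow> 'm \<Rightarrow> real) \<Rightarrow> bool" where
  "vector_field E X \<longleftrightarrow>
     (\<forall>f\<in>smooth_funs E. X f \<in> smooth_funs E) \<and>
     (\<forall>f\<in>smooth_funs E. \<forall>g\<in>smooth_funs E. \<forall>c. X (\<lambda>x. c * f x + g x) = (\<lambda>x. c * X f x + X g x)) \<and>
     (\<forall>f\<in>smooth_funs E. \<forall>g\<in>smooth_funs E. X (\<lambda>x. f x * g x) = (\<lambda>x. X f x * g x + f x * X g x))"


section \<open>Sections of the exterior powers\<close>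

text \<open>
  The $n$-th exterior power of a (finite-dimensional) fibre is realised as the space of alternating
  $n$-linear forms on the dual of the fibre. All degrees share the type
  \<open>('v \<Rightarrow> real) list \<Rightarrow> real\<close>: an element of degree \<open>n\<close> vanishes on lists that are not
  lists of \<open>n\<close> covectors, and an element of the direct sum over \<open>n\<close> is the sum of its homogeneous
  components. Covectors at \<open>x\<close> are extended by \<open>0\<close> outside \<open>fib E x\<close>, so that they are determined by
  their restriction to the fibre.
\<close>

type_synonym ('m, 'v) multisection = "'m \<Rightarrow> ('v \<Rightarrow> real) list \<Rightarrow> real"

definition covectors ::
    "('m, 'v::real_vector, 'z) vbundle_scheme \<Rightarrow> 'm \<Rightarrow> ('v \<Rightarrow> real) set" where
  "covectors E x = {\<alpha>. (\<forall>v. v \<notin> fib E x \<longrightarrow> \<alpha> v = 0) \<and>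
     (\<forall>u\<in>fib E x. \<forall>v\<in>fib E x. \<forall>c. \<alpha> (c *\<^sub>R u + v) = c * \<alpha> u + \<alpha> v)}"

definition ext_power ::
    "('m, 'v::real_vector, 'z) vbundle_scheme \<Rightarrow> nat \<Rightarrow> 'm \<Rightarrow> (('v \<Rightarrow> real) list \<Rightarrow> real) set" where
  "ext_power E n x = {T.
     (\<forall>as. \<not> (length as = n \<and> set as \<subseteq> covectors E x) \<longrightarrow> T as = 0) \<and>
     (\<forall>us vs a b c. set us \<union> set vs \<union> {a, b} \<subseteq> covectors E x \<longrightarrow>
        T (us @ [\<lambda>v. c * a v + b v] @ vs) = c * T (us @ [a] @ vs) + T (us @ [b] @ vs)) \<and>
     (\<forall>as. \<not> distinct as \<longrightarrow> T as = 0)}"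

definition coord_covector ::
    "('m, 'v, 'z) vbundle_scheme \<Rightarrow> ('m \<Rightarrow> 'v \<Rightarrow> nat \<Rightarrow> real) \<Rightarrow> 'm \<Rightarrow> nat \<Rightarrow> 'v \<Rightarrow> real" where
  "coord_covector E \<psi> x i = (\<lambda>v. if v \<in> fib E x then \<psi> x v i else 0)"

text \<open>The smooth sections of the $n$-th exterior power.\<close>

definition ext_sections ::
    "('m, 'v::real_vector, 'z) vbundle_scheme \<Rightarrow> nat \<Rightarrow> ('m, 'v) multisection set" where
  "ext_sections E n = {P. (\<forall>x. P x \<in> ext_power E n x) \<and>
     (\<forall>(U, \<psi>)\<in>trivs E. \<forall>is. length is = n \<and> set is \<subseteq> {..<fib_dim E} \<longrightarrow>
        smooth_on E U (\<lambda>x. P x (map (coord_covector E \<psi> x) is)))}"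

definition ext_sections_all ::
    "('m, 'v::real_vector, 'z) vbundle_scheme \<Rightarrow> ('m, 'v) multisection set" where
  "ext_sections_all E = {\<Sum>n\<le>N. p n | p N. \<forall>n. p n \<in> ext_sections E n}"

definition ext_sections_ge1 ::
    "('m, 'v::real_vector, 'z) vbundle_scheme \<Rightarrow> ('m, 'v) multisection set" where
  "ext_sections_ge1 E = {\<Sum>n=1..N. p n | p N. \<forall>n. p n \<in> ext_sections E n}"

text \<open>The identifications of functions and of sections with the degrees 0 and 1.\<close>

definition ext_of_fun :: "('m \<Rightarrow> real) \<Rightarrow> ('m, 'v) multisection" where
  "ext_of_fun f = (\<lambda>x as. if as = [] then f x else 0)"

definition ext_of_section ::
    "('m, 'v::real_vector, 'z) vbundle_scheme \<Rightarrow> ('m \<Rightarrow> 'v) \<Rightarrow> ('m, 'v) multisection" where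
  "ext_of_section E e =
     (\<lambda>x as. if length as = 1 \<and> set as \<subseteq> covectors E x then hd as (e x) else 0)"

definition section_part ::
    "('m, 'v::real_vector, 'z) vbundle_scheme \<Rightarrow> ('m, 'v) multisection \<Rightarrow> 'm \<Rightarrow> 'v" where
  "section_part E P = (\<lambda>x. THE v. v \<in> fib E x \<and> (\<forall>\<alpha>\<in>covectors E x. \<alpha> v = P x [\<alpha>]))"

text \<open>
  The wedge product as a sum over shuffles: \<open>A\<close> is the set of argument positions passed to \<open>P\<close>.
  No factorials occur, so $e_1\wedge\dots\wedge e_n$ evaluates on $\alpha_1,\dots,\alpha_n$ to
  $\det(\alpha_i(e_j))$.
\<close>

definition shuffle_sign :: "nat \<Rightarrow> nat set \<Rightarrow> real" where
  "shuffle_sign k A = (- 1) ^ card {(i, j). i < j \<and> j < k \<and> i \<notin> A \<and> j \<in> A}"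

definition ext_wedge ::
    "('m, 'v) multisection \<Rightarrow> ('m, 'v) multisection \<Rightarrow> ('m, 'v) multisection" where
  "ext_wedge P Q = (\<lambda>x as. \<Sum>A\<in>Pow {..<length as}.
     shuffle_sign (length as) A * P x (nths as A) * Q x (nths as (- A)))"

definition parity_sign :: "nat \<Rightarrow> 'a::ab_group_add \<Rightarrow> 'a" where
  "parity_sign n a = (if even n then a else - a)"

text \<open>
  The extension of the bilinear form is given by its characteristic properties: \<open>B\<close> is bilinear of
  degree $-2$, extends the form on sections, is graded symmetric, vanishes on functions, and satisfies
  the graded Jacobi and Leibniz identities. (An explicit formula in terms of a local frame $\epsilon_a$
  with dual frame $\epsilon^a$ and $g_{ab} = \langle\epsilon_a,\epsilon_b\rangle$ is
  $(-1)^{p-1}\sum_{a,b} g_{ab}\, (\imath_{\epsilon^a}P)\wedge(\imath_{\epsilon^b}Q)$ for $P$ of degree $p$.)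
\<close>

definition extended_form ::
    "('m, 'v::real_vector, 'z) vbundle_scheme \<Rightarrow>
     (('m, 'v) multisection \<Rightarrow> ('m, 'v) multisection \<Rightarrow> ('m, 'v) multisection) \<Rightarrow> bool" where
  "extended_form E B \<longleftrightarrow>
     (\<forall>P\<in>ext_sections_all E. \<forall>Q\<in>ext_sections_all E. \<forall>R\<in>ext_sections_all E. \<forall>c.
        B (\<lambda>x as. c * P x as + Q x as) R = (\<lambda>x as. c * B P R x as + B Q R x as) \<and>
        B R (\<lambda>x as. c * P x as + Q x as) = (\<lambda>x as. c * B R P x as + B R Q x as)) \<and>
     (\<forall>p\<ge>1. \<forall>q\<ge>1. \<forall>P\<in>ext_sections E p. \<forall>Q\<in>ext_sections E q. B P Q \<in> ext_sections E (p + q - 2)) \<and>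
     (\<forall>e\<in>sections E. \<forall>e'\<in>sections E.
        B (ext_of_section E e) (ext_of_section E e') = ext_of_fun (pairing E e e')) \<and>
     (\<forall>p q. \<forall>P\<in>ext_sections E p. \<forall>Q\<in>ext_sections E q. B P Q = - parity_sign (p * q) (B Q P)) \<and>
     (\<forall>F\<in>ext_sections E 0. \<forall>R\<in>ext_sections_all E. B F R = 0 \<and> B R F = 0) \<and>
     (\<forall>p q. \<forall>P\<in>ext_sections E p. \<forall>Q\<in>ext_sections E q. \<forall>R\<in>ext_sections_all E.
        B P (B Q R) = B (B P Q) R + parity_sign (p * q) (B Q (B P R))) \<and>
     (\<forall>p q. \<forall>P\<in>ext_sections E p. \<forall>Q\<in>ext_sections E q. \<forall>R\<in>ext_sections_all E.
        B P (ext_wedge Q R) = ext_wedge (B P Q) R + parity_sign (p * q) (ext_wedge Q (B P R)))"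


section \<open>Pre-multi-Courant structures\<close>

text \<open>
  A pair \<open>(f, F)\<close> collects the homogeneous components of an element: \<open>f\<close> is the component of
  degree 0, and \<open>F\<close> restricted to lists of length \<open>n\<close> is the component of degree \<open>n + 1\<close>, an
  $n$-ary map on sections. A section is a component of arity 0. Maps are extended by \<open>0\<close> to lists
  that do not consist of sections.
\<close>

type_synonym ('m, 'v) cochain = "('m \<Rightarrow> real) \<times> (('m \<Rightarrow> 'v) list \<Rightarrow> 'm \<Rightarrow> 'v)"

definition is_symbol ::
    "('m, 'v::real_vector, 'z) vbundle_scheme \<Rightarrow> nat \<Rightarrow> (('m \<Rightarrow> 'v) list \<Rightarrow> 'm \<Rightarrow> 'v) \<Rightarrow>
     (('m \<Rightarrow> 'v) list \<Rightarrow> ('m \<Rightarrow> real) \<Rightarrow> 'm \<Rightarrow> real) \<Rightarrow> bool" where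
  "is_symbol E n C \<sigma> \<longleftrightarrow>
     (\<forall>es. length es = n - 1 \<and> set es \<subseteq> sections E \<longrightarrow> vector_field E (\<sigma> es)) \<and>
     (\<forall>es e e'. length es = n - 1 \<and> set es \<union> {e, e'} \<subseteq> sections E \<longrightarrow>
        \<sigma> es (pairing E e e') = pairing E (C (es @ [e])) e' + pairing E e (C (es @ [e']))) \<and>
     (\<forall>us a b vs e. length us + length vs + 2 = n \<and>
        set us \<union> set vs \<union> {a, b, e} \<subseteq> sections E \<longrightarrow>
        pairing E (C (us @ [a, b] @ vs) + C (us @ [b, a] @ vs)) e =
          \<sigma> (us @ vs @ [e]) (pairing E a b))"

definition multilinear ::
    "('m, 'v::real_vector, 'z) vbundle_scheme \<Rightarrow> nat \<Rightarrow> (('m \<Rightarrow> 'v) list \<Rightarrow> 'm \<Rightarrow> 'v) \<Rightarrow> bool" where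
  "multilinear E n C \<longleftrightarrow>
     (\<forall>es. length es = n \<and> set es \<subseteq> sections E \<longrightarrow> C es \<in> sections E) \<and>
     (\<forall>es. \<not> (length es = n \<and> set es \<subseteq> sections E) \<longrightarrow> C es = 0) \<and>
     (\<forall>us a b vs c. length us + length vs + 1 = n \<and>
        set us \<union> set vs \<union> {a, b} \<subseteq> sections E \<longrightarrow>
        C (us @ [\<lambda>x. c *\<^sub>R a x + b x] @ vs) =
          (\<lambda>x. c *\<^sub>R C (us @ [a] @ vs) x + C (us @ [b] @ vs) x))"

definition pre_courant ::
    "('m, 'v::real_vector, 'z) vbundle_scheme \<Rightarrow> nat \<Rightarrow> (('m \<Rightarrow> 'v) list \<Rightarrow> 'm \<Rightarrow> 'v) \<Rightarrow> bool" where
  "pre_courant E n C \<longleftrightarrow> n \<ge> 1 \<and> multilinear E n C \<and> (\<exists>\<sigma>. is_symbol E n C \<sigma>)"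

text \<open>
  On lists of sections and smooth functions the choice is unique, except in rank 0, where it plays no
  role because \<open>sections E\<close> is trivial.
\<close>

definition symbol ::
    "('m, 'v::real_vector, 'z) vbundle_scheme \<Rightarrow> nat \<Rightarrow> (('m \<Rightarrow> 'v) list \<Rightarrow> 'm \<Rightarrow> 'v) \<Rightarrow>
     ('m \<Rightarrow> 'v) list \<Rightarrow> ('m \<Rightarrow> real) \<Rightarrow> 'm \<Rightarrow> real" where
  "symbol E n C = (SOME \<sigma>. is_symbol E n C \<sigma>)"

definition cochain_of_section :: "('m \<Rightarrow> 'v::real_vector) \<Rightarrow> ('m, 'v) cochain" where
  "cochain_of_section e = (0, \<lambda>es. if es = [] then e else 0)"

definition cochains ::
    "('m, 'v::real_vector, 'z) vbundle_scheme \<Rightarrow> nat \<Rightarrow> ('m, 'v) cochain set" where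
  "cochains E k =
     (if k = 0 then {(f, 0) | f. f \<in> smooth_funs E}
      else if k = 1 then cochain_of_section ` sections E
      else {(0, C) | C. pre_courant E (k - 1) C})"

definition component :: "nat \<Rightarrow> ('m, 'v::real_vector) cochain \<Rightarrow> ('m, 'v) cochain" where
  "component k X =
     (if k = 0 then (fst X, 0) else (0, \<lambda>es. if length es = k - 1 then snd X es else 0))"

text \<open>The contraction $\imath_e$; the first component is $\imath_e e_1 = \langle e, e_1\rangle$.\<close>

definition contract ::
    "('m, 'v, 'z) vbundle_scheme \<Rightarrow> ('m \<Rightarrow> 'v) \<Rightarrow> ('m, 'v) cochain \<Rightarrow> ('m, 'v) cochain" where
  "contract E e X = (pairing E e (snd X []), \<lambda>es. snd X (e # es))"

text \<open>The element of degree \<open>k \<ge> 1\<close> with prescribed contractions.\<close>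

definition by_contractions ::
    "('m, 'v::real_vector, 'z) vbundle_scheme \<Rightarrow> nat \<Rightarrow> (('m \<Rightarrow> 'v) \<Rightarrow> ('m, 'v) cochain) \<Rightarrow>
     ('m, 'v) cochain" where
  "by_contractions E k G = (THE Z. Z \<in> cochains E k \<and> (\<forall>e\<in>sections E. contract E e Z = G e))"

text \<open>
  The bracket of elements of degrees \<open>n\<close> and \<open>m\<close>. In the recursive rule, terms
  $[[e, f], C]$ with \<open>f\<close> of degree 0 vanish and are omitted.
\<close>

fun KW_hom ::
    "('m, 'v::real_vector, 'z) vbundle_scheme \<Rightarrow> nat \<Rightarrow> nat \<Rightarrow>
     ('m, 'v) cochain \<Rightarrow> ('m, 'v) cochain \<Rightarrow> ('m, 'v) cochain" where
  "KW_hom E 0 0 X Y = 0"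
| "KW_hom E (Suc 0) m X Y = contract E (snd X []) Y"
| "KW_hom E n (Suc 0) X Y = parity_sign (n + 1) (contract E (snd Y []) X)"
| "KW_hom E 0 (Suc (Suc 0)) X Y = (symbol E 1 (snd Y) [] (fst X), 0)"
| "KW_hom E (Suc (Suc 0)) 0 X Y = (- symbol E 1 (snd X) [] (fst Y), 0)"
| "KW_hom E 0 (Suc (Suc (Suc m))) X Y =
     by_contractions E (Suc m) (\<lambda>e. KW_hom E 0 (Suc (Suc m)) X (contract E e Y))"
| "KW_hom E (Suc (Suc (Suc n))) 0 X Y =
     by_contractions E (Suc n) (\<lambda>e. KW_hom E (Suc (Suc n)) 0 (contract E e X) Y)"
| "KW_hom E (Suc (Suc n)) (Suc (Suc m)) X Y =
     by_contractions E (Suc (Suc n) + Suc (Suc m) - 2)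
       (\<lambda>e. KW_hom E (Suc n) (Suc (Suc m)) (contract E e X) Y +
            parity_sign n (KW_hom E (Suc (Suc n)) (Suc m) X (contract E e Y)))"

text \<open>The bilinear extension of the bracket to the direct sum.\<close>

definition KW_bracket ::
    "('m, 'v::real_vector, 'z) vbundle_scheme \<Rightarrow>
     ('m, 'v) cochain \<Rightarrow> ('m, 'v) cochain \<Rightarrow> ('m, 'v) cochain" where
  "KW_bracket E X Y =
     (\<Sum>n\<in>{n. component n X \<noteq> 0}. \<Sum>m\<in>{m. component m Y \<noteq> 0}.
        KW_hom E n m (component n X) (component m Y))"

text \<open>
  A multisection \<open>P\<close> as an element of the direct sum: in degree $p\geq 1$,
  $P(e_1,\dots,e_{p-1}) = \langle e_{p-1},\dots\langle e_2,\langle e_1,P\rangle\rangle\dots\rangle$.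
  Here $\imath_e$ acts on \<open>P\<close> as $\langle e, \cdot\rangle$, which is a derivation of the wedge product;
  hence $e_1\wedge\dots\wedge e_p$ is sent to the product of the $e_i$ in the algebra of
  pre-multi-Courant structures. Components of \<open>P\<close> of other degrees do not contribute, since
  \<open>section_part\<close> only sees degree 1.
\<close>

definition as_cochain ::
    "('m, 'v::real_vector, 'z) vbundle_scheme \<Rightarrow>
     (('m, 'v) multisection \<Rightarrow> ('m, 'v) multisection \<Rightarrow> ('m, 'v) multisection) \<Rightarrow>
     ('m, 'v) multisection \<Rightarrow> ('m, 'v) cochain" where
  "as_cochain E B P =
     ((\<lambda>x. P x []),
      (\<lambda>es. if set es \<subseteq> sections E
            then section_part E (fold (\<lambda>e. B (ext_of_section E e)) es P) else 0))"

end

theory Submission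
  imports Defs
begin

text \<open>
  Contraction \<open>\<imath>\<^sub>e\<close> of a multisection, regarded as a cochain, is \<open>\<langle>e, \<cdot>\<rangle>\<close>. By the Jacobi identity and
  because functions are central, these contractions anticommute, so a multisection is a
  pre-multi-Courant structure with vanishing symbol. The Jacobi identity for \<open>\<langle>\<cdot>, \<cdot>\<rangle>\<close> with a section in
  the first slot is then the recursion defining the bracket, and the two brackets agree by induction
  on the degrees.
\<close>

text \<open>The obstacle is that the recursive step of the bracket is a definite description:
  \<open>by_contractions\<close> can be evaluated only at contractions that belong to exactly one
  element of \<open>cochains\<close>. Existence is why the cochain of \<open>B P Q\<close> has to be
  recognised as a genuine pre-multi-Courant structure, with values that are smooth sections. This
  requires closure of sections under linear combinations and the identification of each fibre with
  its double dual, since \<open>section_part\<close> is a description as well. Uniqueness holds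
  because a map of positive arity is determined by fixing its first argument.

  A second point concerns the direct sum. \<open>KW_bracket\<close> runs only over the degrees in
  which a cochain is nonzero, so a homogeneous part of \<open>P\<close> with vanishing cochain is
  dropped, and its contribution to \<open>B P Q\<close> must vanish too. This follows from the
  homogeneous case itself: there the cochain of \<open>B P Q\<close> depends on \<open>P\<close> and
  \<open>Q\<close> only through their cochains.\<close>

section \<open>Linear combinations of smooth functions\<close>

lemma smooth_on_zero: "smooth_on E W (\<lambda>_. 0)"
proof -
  have "foldr partial is (\<lambda>_. 0) = (\<lambda>_. 0)" for "is"
    by (induction "is") (auto simp: partial_def)
  then show ?thesis
    by (auto simp: smooth_on_def smooth_coord_def o_def)
qed

text \<open>\<open>S\<close> is open only relative to the subspace where the coordinates from
  \<open>d\<close> on vanish; \<open>i < d\<close> keeps the coordinate line through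
  \<open>x\<close> inside that subspace.\<close>

lemma eventually_fun_upd_in_openin_Euclidean_space:
  assumes "openin (Euclidean_space d) S" "x \<in> S" "i < d"
  shows "eventually (\<lambda>t. x(i := t) \<in> S) (nhds (x i))"
proof -
  obtain T where "openin (powertop_real UNIV) T" and S: "S = T \<inter> {x. \<forall>i\<ge>d. x i = 0}"
    using assms(1) by (auto simp: Euclidean_space_def openin_subtopology)
  then have T: "open T" by (simp add: open_fun_def)
  have "continuous_on UNIV (\<lambda>t. x(i := t))"
  proof (rule continuous_on_coordinatewise_then_product)
    show "continuous_on UNIV (\<lambda>t. (x(i := t)) j)" for j
      by (cases "j = i") auto
  qed
  then have "open ((\<lambda>t. x(i := t)) -` T)"
    using T by (simp add: continuous_on_open_vimage)
  moreover have "x i \<in> (\<lambda>t. x(i := t)) -` T"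
    using assms(2) S by simp
  ultimately have "eventually (\<lambda>t. x(i := t) \<in> T) (nhds (x i))"
    using eventually_nhds_in_open by fastforce
  then show ?thesis
    by eventually_elim (use assms S in auto)
qed

text \<open>
  The iterated partial derivatives on \<open>S\<close> are those of functions on the whole coordinate space, whose
  values away from \<open>S\<close> are arbitrary; only the openness of \<open>S\<close> makes them insensitive to these values.
\<close>

lemma smooth_coord_lincomb:
  assumes S: "openin (Euclidean_space d) S"
    and f: "smooth_coord d S f" and g: "smooth_coord d S g"
    and h: "\<And>x. x \<in> S \<Longrightarrow> h x = c * f x + g x"
  shows "smooth_coord d S h"
proof -
  have diff: "(\<lambda>t. foldr partial is k (x(i := t))) differentiable (at (x i))"
    if "smooth_coord d S k" "set is \<subseteq> {..<d}" "x \<in> S" "i < d" for k "is" x i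
    using that by (auto simp: smooth_coord_def)
  have ev: "eventually (\<lambda>t. foldr partial is h (x(i := t)) =
      c * foldr partial is f (x(i := t)) + foldr partial is g (x(i := t))) (nhds (x i))"
    if "\<And>y. y \<in> S \<Longrightarrow> foldr partial is h y = c * foldr partial is f y + foldr partial is g y"
      and "x \<in> S" "i < d" for "is" x i
    using eventually_fun_upd_in_openin_Euclidean_space[OF S that(2,3)]
    by eventually_elim (rule that(1))
  \<comment> \<open>The equation is assumed on all of \<open>S\<close>, not only at
    \<open>x\<close>, because a derivative at \<open>x\<close> sees nearby points; the induction on
    \<open>is\<close> below supplies it in this form.\<close>
  have der: "((\<lambda>t. foldr partial is h (x(i := t))) has_real_derivative
      c * deriv (\<lambda>t. foldr partial is f (x(i := t))) (x i) +
      deriv (\<lambda>t. foldr partial is g (x(i := t))) (x i)) (at (x i))"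
    if eq: "\<And>y. y \<in> S \<Longrightarrow> foldr partial is h y = c * foldr partial is f y + foldr partial is g y"
      and x: "set is \<subseteq> {..<d}" "x \<in> S" "i < d" for "is" x i
  proof -
    have "((\<lambda>t. c * foldr partial is f (x(i := t)) + foldr partial is g (x(i := t))) has_real_derivative
        c * deriv (\<lambda>t. foldr partial is f (x(i := t))) (x i) +
        deriv (\<lambda>t. foldr partial is g (x(i := t))) (x i)) (at (x i))"
      using diff[OF f x] diff[OF g x]
      by (intro DERIV_add DERIV_cmult) (simp_all only: DERIV_deriv_iff_real_differentiable)
    then show ?thesis
      by (subst DERIV_cong_ev[OF refl ev[OF eq x(2,3)] refl])
  qed
  have eq: "foldr partial is h x = c * foldr partial is f x + foldr partial is g x"
    if "set is \<subseteq> {..<d}" "x \<in> S" for "is" x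
    using that
  proof (induction "is" arbitrary: x)
    case Nil
    then show ?case using h by simp
  next
    case (Cons i "is")
    then show ?case
      using DERIV_imp_deriv[OF der[of "is" x i]] by (simp add: partial_def[of i])
  qed
  have "continuous_on S (foldr partial is h)" if "is": "set is \<subseteq> {..<d}" for "is"
  proof -
    have "continuous_on S (\<lambda>x. c * foldr partial is f x + foldr partial is g x)"
      using f g "is" by (intro continuous_intros) (auto simp: smooth_coord_def)
    then show ?thesis
      using eq[OF "is"] by (simp cong: continuous_on_cong)
  qed
  moreover have "(\<lambda>t. foldr partial is h (x(i := t))) differentiable (at (x i))"
    if "set is \<subseteq> {..<d}" "x \<in> S" "i < d" for "is" x i
    using der[OF eq that] that real_differentiable_def by blast
  ultimately show "smooth_coord d S h"
    by (auto simp: smooth_coord_def)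
qed

text \<open>A chart is a homeomorphism onto an open set, so it carries the open set
  \<open>U \<inter> W\<close> to an open set of coordinate space, where the coordinate version
  applies.\<close>

lemma smooth_on_lincomb:
  assumes E: "smooth_manifold E" and W: "open W"
    and f: "smooth_on E W f" and g: "smooth_on E W g"
    and h: "\<And>x. x \<in> W \<Longrightarrow> h x = c * f x + g x"
  shows "smooth_on E W h"
  unfolding smooth_on_def
proof (intro ballI, clarify)
  fix U \<phi> assume chart: "(U, \<phi>) \<in> atlas E"
  let ?d = "dim_base E"
  have U: "openin (Euclidean_space ?d) (\<phi> ` U)"
    and \<phi>: "homeomorphic_map (top_of_set U) (subtopology (Euclidean_space ?d) (\<phi> ` U)) \<phi>"
    using E chart by (auto simp: smooth_manifold_def)
  have inj: "inj_on \<phi> U"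
    using homeomorphic_imp_injective_map[OF \<phi>] by simp
  have "openin (top_of_set U) (U \<inter> W)"
    using W by (simp add: openin_open_Int)
  then have "openin (subtopology (Euclidean_space ?d) (\<phi> ` U)) (\<phi> ` (U \<inter> W))"
    using homeomorphic_map_openness[OF \<phi>] by auto
  then have "openin (Euclidean_space ?d) (\<phi> ` (U \<inter> W))"
    using U openin_trans_full by blast
  moreover have "smooth_coord ?d (\<phi> ` (U \<inter> W)) (f \<circ> inv_into U \<phi>)"
    and "smooth_coord ?d (\<phi> ` (U \<inter> W)) (g \<circ> inv_into U \<phi>)"
    using f g chart by (auto simp: smooth_on_def)
  moreover have "(h \<circ> inv_into U \<phi>) y = c * (f \<circ> inv_into U \<phi>) y + (g \<circ> inv_into U \<phi>) y"
    if "y \<in> \<phi> ` (U \<inter> W)" for y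
    using that h inj by auto
  ultimately show "smooth_coord ?d (\<phi> ` (U \<inter> W)) (h \<circ> inv_into U \<phi>)"
    by (rule smooth_coord_lincomb)
qed

text \<open>Iterated partial derivatives are taken of functions defined beyond \<open>W\<close>, so
  agreement on \<open>W\<close> suffices only because \<open>W\<close> is open. The case
  \<open>1 * f + 0\<close> of the previous lemma already accounts for this.\<close>

lemma smooth_on_cong:
  assumes "smooth_manifold E" "open W" "smooth_on E W f" "\<And>x. x \<in> W \<Longrightarrow> f x = g x"
  shows "smooth_on E W g"
  using assms smooth_on_zero by (intro smooth_on_lincomb[of E W f "\<lambda>_. 0" g 1]) auto

section \<open>Homogeneous multisections and their sums\<close>

lemma sum_apply1: "sum p I x = (\<Sum>i\<in>I. p i x)"
  by (induction I rule: infinite_finite_induct) auto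

lemma sum_apply2: "sum p I x y = (\<Sum>i\<in>I. p i x y)"
  by (induction I rule: infinite_finite_induct) auto

lemma zero_in_ext_sections: "0 \<in> ext_sections E n"
  using smooth_on_zero[of E] by (auto simp: ext_sections_def ext_power_def zero_fun_def)

lemma ext_sections_eq_zero:
  assumes "P \<in> ext_sections E n" "length as \<noteq> n"
  shows "P x as = 0"
  using assms by (auto simp: ext_sections_def ext_power_def)

lemma ext_sections_imp_all:
  assumes "P \<in> ext_sections E n"
  shows "P \<in> ext_sections_all E"
proof -
  have "P = (\<Sum>k\<le>n. if k = n then P else 0)"
    by simp
  moreover have "\<forall>k. (if k = n then P else 0) \<in> ext_sections E k"
    using assms zero_in_ext_sections by auto
  ultimately show ?thesis
    unfolding ext_sections_all_def by blast
qed

section \<open>Sections and multisections as vector spaces\<close>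

locale metric_bundle_form =
  fixes E :: "('m::{t2_space, second_countable_topology}, 'v::real_vector, 'z) vbundle_scheme"
    and B :: "('m, 'v) multisection \<Rightarrow> ('m, 'v) multisection \<Rightarrow> ('m, 'v) multisection"
  assumes metric_bundle: "metric_bundle E"
    and extended_form: "extended_form E B"
begin

abbreviation "\<epsilon> \<equiv> ext_of_section E"
abbreviation "\<iota> \<equiv> as_cochain E B"

lemma subspace_fib: "subspace (fib E x)"
  using metric_bundle by (auto simp: metric_bundle_def vector_bundle_def)

lemma smooth_manifold: "smooth_manifold E"
  and triv_open: "(U, \<psi>) \<in> trivs E \<Longrightarrow> open U"
  using metric_bundle by (auto simp: metric_bundle_def vector_bundle_def)

lemma fib_lincomb: "u \<in> fib E x \<Longrightarrow> v \<in> fib E x \<Longrightarrow> c *\<^sub>R u + v \<in> fib E x"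
  by (intro subspace_add subspace_scale subspace_fib)

lemma trivs_cover:
  obtains U \<psi> where "(U, \<psi>) \<in> trivs E" "x \<in> U"
proof -
  have "(\<Union>(U, \<psi>)\<in>trivs E. U) = UNIV"
    using metric_bundle by (auto simp: metric_bundle_def vector_bundle_def)
  then have "x \<in> (\<Union>(U, \<psi>)\<in>trivs E. U)" by simp
  then show ?thesis using that by auto
qed

lemma
  assumes "(U, \<psi>) \<in> trivs E" "x \<in> U"
  shows triv_bij: "bij_betw (\<psi> x) (fib E x) (topspace (Euclidean_space (fib_dim E)))"
    and triv_lincomb: "u \<in> fib E x \<Longrightarrow> v \<in> fib E x \<Longrightarrow> \<psi> x (c *\<^sub>R u + v) i = c * \<psi> x u i + \<psi> x v i"
proof -
  have "\<forall>(U, \<psi>)\<in>trivs E.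
        open U \<and>
        (\<forall>x\<in>U.
           bij_betw (\<psi> x) (fib E x) (topspace (Euclidean_space (fib_dim E))) \<and>
           (\<forall>u\<in>fib E x. \<forall>v\<in>fib E x. \<forall>c i. \<psi> x (c *\<^sub>R u + v) i = c * \<psi> x u i + \<psi> x v i))"
    using metric_bundle by (auto simp: metric_bundle_def vector_bundle_def)
  with assms show "bij_betw (\<psi> x) (fib E x) (topspace (Euclidean_space (fib_dim E)))"
    and "u \<in> fib E x \<Longrightarrow> v \<in> fib E x \<Longrightarrow> \<psi> x (c *\<^sub>R u + v) i = c * \<psi> x u i + \<psi> x v i"
    by auto
qed

lemma sections_lincomb:
  assumes a: "a \<in> sections E" and b: "b \<in> sections E"
  shows "(\<lambda>x. c *\<^sub>R a x + b x) \<in> sections E"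
proof -
  have fib: "a x \<in> fib E x" "b x \<in> fib E x" for x
    using a b by (auto simp: sections_def)
  have "smooth_on E U (\<lambda>x. \<psi> x (c *\<^sub>R a x + b x) i)"
    if triv: "(U, \<psi>) \<in> trivs E" and i: "i < fib_dim E" for U \<psi> i
  proof (rule smooth_on_lincomb[OF smooth_manifold triv_open[OF triv]])
    show "smooth_on E U (\<lambda>x. \<psi> x (a x) i)" "smooth_on E U (\<lambda>x. \<psi> x (b x) i)"
      using a b triv i by (auto simp: sections_def)
    show "\<psi> x (c *\<^sub>R a x + b x) i = c * \<psi> x (a x) i + \<psi> x (b x) i" if "x \<in> U" for x
      using triv_lincomb[OF triv that] fib by blast
  qed
  then show ?thesis
    using fib fib_lincomb by (auto simp: sections_def)
qed

lemma ext_sections_lincomb: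
  assumes P: "P \<in> ext_sections E n" and Q: "Q \<in> ext_sections E n"
  shows "(\<lambda>x as. c * P x as + Q x as) \<in> ext_sections E n"
proof -
  have "(\<lambda>as. c * P x as + Q x as) \<in> ext_power E n x" for x
  proof -
    have "P x \<in> ext_power E n x" "Q x \<in> ext_power E n x"
      using P Q by (auto simp: ext_sections_def)
    then show ?thesis
      unfolding ext_power_def by (simp add: algebra_simps)
  qed
  moreover have "smooth_on E U (\<lambda>x. c * P x (map (coord_covector E \<psi> x) is) + Q x (map (coord_covector E \<psi> x) is))"
    if triv: "(U, \<psi>) \<in> trivs E" and "is": "length is = n" "set is \<subseteq> {..<fib_dim E}" for U \<psi> "is"
  proof (rule smooth_on_lincomb[OF smooth_manifold triv_open[OF triv], where c = c])
    show "smooth_on E U (\<lambda>x. P x (map (coord_covector E \<psi> x) is))"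
      and "smooth_on E U (\<lambda>x. Q x (map (coord_covector E \<psi> x) is))"
      using P Q triv "is" by (auto simp: ext_sections_def)
  qed simp
  ultimately show ?thesis
    by (auto simp: ext_sections_def)
qed

lemma ext_sections_add:
  "P \<in> ext_sections E n \<Longrightarrow> Q \<in> ext_sections E n \<Longrightarrow> P + Q \<in> ext_sections E n"
  using ext_sections_lincomb[of P n Q 1] by (simp add: plus_fun_def)

lemma ext_sections_all_add:
  assumes "P \<in> ext_sections_all E" "Q \<in> ext_sections_all E"
  shows "P + Q \<in> ext_sections_all E"
proof -
  \<comment> \<open>Filling up with zeros makes every large bound admissible, so that two sums can
    be added degree by degree over a common range.\<close>
  have pad: "\<exists>p. (\<forall>n. p n \<in> ext_sections E n) \<and> (\<exists>N. \<forall>K\<ge>N. R = (\<Sum>n\<le>K. p n))"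
    if R: "R \<in> ext_sections_all E" for R
  proof -
    obtain p N where R: "R = (\<Sum>n\<le>N. p n)" and p: "\<forall>n. p n \<in> ext_sections E n"
      using R by (auto simp: ext_sections_all_def)
    have "R = (\<Sum>n\<le>K. if n \<le> N then p n else 0)" if "K \<ge> N" for K
      unfolding R using that by (intro sum.mono_neutral_cong_left) auto
    moreover have "\<forall>n. (if n \<le> N then p n else 0) \<in> ext_sections E n"
      using p zero_in_ext_sections by auto
    ultimately show ?thesis
      by (intro exI[of _ "\<lambda>n. if n \<le> N then p n else 0"] conjI exI[of _ N]) auto
  qed
  obtain p N where p: "\<forall>n. p n \<in> ext_sections E n" and P: "\<forall>K\<ge>N. P = (\<Sum>n\<le>K. p n)"
    using pad[OF assms(1)] by blast
  obtain q M where q: "\<forall>n. q n \<in> ext_sections E n" and Q: "\<forall>K\<ge>M. Q = (\<Sum>n\<le>K. q n)"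
    using pad[OF assms(2)] by blast
  have "P + Q = (\<Sum>n\<le>max N M. p n + q n)"
    unfolding sum.distrib using P Q by (metis max.cobounded1 max.cobounded2)
  moreover have "\<forall>n. p n + q n \<in> ext_sections E n"
    using p q ext_sections_add by blast
  ultimately show ?thesis
    unfolding ext_sections_all_def by blast
qed

lemma ext_sections_all_sum:
  "(\<And>i. i \<in> I \<Longrightarrow> f i \<in> ext_sections_all E) \<Longrightarrow> sum f I \<in> ext_sections_all E"
  by (induction I rule: infinite_finite_induct)
    (auto simp: ext_sections_all_add ext_sections_imp_all[OF zero_in_ext_sections])

section \<open>Duality between fibres and covectors\<close>

lemma coord_covector_in_covectors:
  assumes "(U, \<psi>) \<in> trivs E" "x \<in> U"
  shows "coord_covector E \<psi> x i \<in> covectors E x"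
  using triv_lincomb[OF assms] fib_lincomb
  by (auto simp: covectors_def coord_covector_def)

lemma covector_lincomb:
  "\<alpha> \<in> covectors E x \<Longrightarrow> u \<in> fib E x \<Longrightarrow> v \<in> fib E x \<Longrightarrow> \<alpha> (c *\<^sub>R u + v) = c * \<alpha> u + \<alpha> v"
  by (auto simp: covectors_def)

lemma covector_zero: "\<alpha> \<in> covectors E x \<Longrightarrow> \<alpha> 0 = 0"
  using covector_lincomb[of \<alpha> x 0 0 1] subspace_0[OF subspace_fib] by simp

lemma covector_sum:
  assumes "\<alpha> \<in> covectors E x" "finite I" "\<And>i. i \<in> I \<Longrightarrow> b i \<in> fib E x"
  shows "\<alpha> (\<Sum>i\<in>I. c i *\<^sub>R b i) = (\<Sum>i\<in>I. c i * \<alpha> (b i))"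
  using assms(2,3)
proof (induction I rule: finite_induct)
  case empty
  then show ?case using covector_zero[OF assms(1)] by simp
next
  case (insert j I)
  have "(\<Sum>i\<in>I. c i *\<^sub>R b i) \<in> fib E x"
    using insert.prems by (intro subspace_sum subspace_fib subspace_scale) auto
  with insert show ?case
    using covector_lincomb[OF assms(1)] by simp
qed

text \<open>The coordinates of a local trivialisation are covectors, and they separate the points of
  the fibre.\<close>

lemma fib_eqI:
  assumes "u \<in> fib E x" "v \<in> fib E x" "\<And>\<alpha>. \<alpha> \<in> covectors E x \<Longrightarrow> \<alpha> u = \<alpha> v"
  shows "u = v"
proof -
  obtain U \<psi> where triv: "(U, \<psi>) \<in> trivs E" "x \<in> U" by (rule trivs_cover)
  have "\<psi> x u i = \<psi> x v i" for i
    using assms(3)[OF coord_covector_in_covectors[OF triv, of i]] assms(1,2)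
    by (simp add: coord_covector_def)
  then have "\<psi> x u = \<psi> x v" by blast
  then show ?thesis
    using bij_betw_imp_inj_on[OF triv_bij[OF triv]] assms(1,2) by (auto simp: inj_on_def)
qed

lemma triv_basis:
  assumes triv: "(U, \<psi>) \<in> trivs E" "x \<in> U"
  obtains b where "\<And>i. i < fib_dim E \<Longrightarrow> b i \<in> fib E x"
    and "\<And>u. u \<in> fib E x \<Longrightarrow> u = (\<Sum>i<fib_dim E. \<psi> x u i *\<^sub>R b i)"
proof -
  let ?d = "fib_dim E"
  let ?\<delta> = "\<lambda>i j. if j = i then 1 else 0 :: real"
  note bij = triv_bij[OF triv]
  \<comment> \<open>The preimages of the unit vectors form the basis dual to the coordinate
    covectors.\<close>
  define b where "b i = inv_into (fib E x) (\<psi> x) (?\<delta> i)" for i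
  have \<delta>: "?\<delta> i \<in> \<psi> x ` fib E x" if "i < ?d" for i
    using that bij_betw_imp_surj_on[OF bij] by (auto simp: topspace_Euclidean_space)
  have b: "b i \<in> fib E x" "\<psi> x (b i) = ?\<delta> i" if "i < ?d" for i
    using \<delta>[OF that] unfolding b_def by (rule inv_into_into, rule f_inv_into_f)
  have "u = (\<Sum>i<?d. \<psi> x u i *\<^sub>R b i)" if u: "u \<in> fib E x" for u
  proof -
    let ?s = "\<Sum>i<?d. \<psi> x u i *\<^sub>R b i"
    have s: "?s \<in> fib E x"
      using b by (intro subspace_sum subspace_fib subspace_scale) auto
    have "\<psi> x ?s j = \<psi> x u j" for j
    proof -
      have "\<psi> x ?s j = coord_covector E \<psi> x j ?s"
        using s by (simp add: coord_covector_def)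
      also have "\<dots> = (\<Sum>i<?d. \<psi> x u i * ?\<delta> i j)"
        using b by (subst covector_sum[OF coord_covector_in_covectors[OF triv]])
          (auto simp: coord_covector_def)
      also have "\<dots> = (if j < ?d then \<psi> x u j else 0)"
        by (auto simp: if_distrib cong: if_cong)
      \<comment> \<open>For \<open>j \<ge> ?d\<close> both sides are zero: points of coordinate
        space vanish at these indices.\<close>
      also have "\<dots> = \<psi> x u j"
        using bij_betw_apply[OF bij u] by (auto simp: topspace_Euclidean_space)
      finally show ?thesis .
    qed
    then have "\<psi> x u = \<psi> x ?s" by (intro ext) simp
    then show ?thesis
      by (rule inj_onD[OF bij_betw_imp_inj_on[OF bij] _ u s])
  qed
  with b show ?thesis using that by blast
qed

lemma ext_power_1_lincomb:
  assumes "T \<in> ext_power E 1 x" "\<alpha> \<in> covectors E x" "\<beta> \<in> covectors E x"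
  shows "T [\<lambda>v. c * \<alpha> v + \<beta> v] = c * T [\<alpha>] + T [\<beta>]"
proof -
  have "\<forall>us vs a b c. set us \<union> set vs \<union> {a, b} \<subseteq> covectors E x \<longrightarrow>
        T (us @ [\<lambda>v. c * a v + b v] @ vs) = c * T (us @ [a] @ vs) + T (us @ [b] @ vs)"
    using assms(1) unfolding ext_power_def by blast
  from this[rule_format, of "[]" "[]" \<alpha> \<beta> c] show ?thesis
    using assms(2,3) by simp
qed

lemma ext_power_1_sum:
  assumes T: "T \<in> ext_power E 1 x" and "finite I" "\<And>i. i \<in> I \<Longrightarrow> \<alpha> i \<in> covectors E x"
  shows "(\<lambda>v. \<Sum>i\<in>I. c i * \<alpha> i v) \<in> covectors E x \<and>
    T [\<lambda>v. \<Sum>i\<in>I. c i * \<alpha> i v] = (\<Sum>i\<in>I. c i * T [\<alpha> i])"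
  using assms(2,3)
proof (induction I rule: finite_induct)
  case empty
  have 0: "(\<lambda>v. 0) \<in> covectors E x" by (simp add: covectors_def)
  with ext_power_1_lincomb[OF T 0 0, of 1] show ?case by simp
next
  case (insert j I)
  let ?\<beta> = "\<lambda>v. \<Sum>i\<in>I. c i * \<alpha> i v"
  have \<beta>: "?\<beta> \<in> covectors E x" "T [?\<beta>] = (\<Sum>i\<in>I. c i * T [\<alpha> i])" and \<alpha>: "\<alpha> j \<in> covectors E x"
    using insert by auto
  have "(\<lambda>v. c j * \<alpha> j v + ?\<beta> v) \<in> covectors E x"
    using \<alpha> \<beta>(1) by (auto simp: covectors_def algebra_simps)
  then show ?case
    using insert.hyps ext_power_1_lincomb[OF T \<alpha> \<beta>(1)] \<beta>(2) by simp
qed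

text \<open>Reflexivity of a finite-dimensional space: a linear form on the covectors is evaluation
  at a vector, whose coefficients in the dual basis are the values of \<open>T\<close> on the
  coordinate covectors.\<close>

lemma ext_power_1_represented:
  assumes T: "T \<in> ext_power E 1 x"
  obtains v where "v \<in> fib E x" "\<And>\<alpha>. \<alpha> \<in> covectors E x \<Longrightarrow> \<alpha> v = T [\<alpha>]"
proof -
  obtain U \<psi> where triv: "(U, \<psi>) \<in> trivs E" "x \<in> U" by (rule trivs_cover)
  obtain b where b: "\<And>i. i < fib_dim E \<Longrightarrow> b i \<in> fib E x"
    and exp: "\<And>u. u \<in> fib E x \<Longrightarrow> u = (\<Sum>i<fib_dim E. \<psi> x u i *\<^sub>R b i)"
    using triv_basis[OF triv] by metis
  let ?c = "coord_covector E \<psi> x"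
  note c = coord_covector_in_covectors[OF triv]
  define v where "v = (\<Sum>i<fib_dim E. T [?c i] *\<^sub>R b i)"
  have "v \<in> fib E x"
    unfolding v_def using b by (intro subspace_sum subspace_fib subspace_scale) auto
  moreover have "\<alpha> v = T [\<alpha>]" if \<alpha>: "\<alpha> \<in> covectors E x" for \<alpha>
  proof -
    have "\<alpha> u = (\<Sum>i<fib_dim E. \<alpha> (b i) * ?c i u)" for u
    proof (cases "u \<in> fib E x")
      case True
      have "\<alpha> u = \<alpha> (\<Sum>i<fib_dim E. \<psi> x u i *\<^sub>R b i)"
        using exp[OF True] by simp
      also have "\<dots> = (\<Sum>i<fib_dim E. \<psi> x u i * \<alpha> (b i))"
        using b by (intro covector_sum[OF \<alpha>]) auto
      finally show ?thesis using True by (simp add: coord_covector_def mult.commute)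
    next
      case False
      then show ?thesis using \<alpha> by (simp add: coord_covector_def covectors_def)
    qed
    then have "\<alpha> = (\<lambda>u. \<Sum>i<fib_dim E. \<alpha> (b i) * ?c i u)" by blast
    then have "T [\<alpha>] = T [\<lambda>u. \<Sum>i<fib_dim E. \<alpha> (b i) * ?c i u]" by (rule arg_cong)
    also have "\<dots> = (\<Sum>i<fib_dim E. \<alpha> (b i) * T [?c i])"
      using ext_power_1_sum[OF T, of "{..<fib_dim E}" ?c] c by auto
    also have "\<dots> = \<alpha> v"
      unfolding v_def using b by (subst covector_sum[OF \<alpha>]) (auto simp: mult.commute)
    finally show ?thesis by simp
  qed
  ultimately show ?thesis using that by blast
qed

section \<open>Sections as multisections of degree 1\<close>

lemma section_part_eqI:
  assumes "v \<in> fib E x" "\<And>\<alpha>. \<alpha> \<in> covectors E x \<Longrightarrow> \<alpha> v = P x [\<alpha>]"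
  shows "section_part E P x = v"
  unfolding section_part_def
proof (rule the_equality)
  show "w = v" if "w \<in> fib E x \<and> (\<forall>\<alpha>\<in>covectors E x. \<alpha> w = P x [\<alpha>])" for w
    using that assms by (intro fib_eqI[of w x v]) auto
qed (use assms in auto)

lemma section_part_zero_if:
  assumes "\<And>x \<alpha>. P x [\<alpha>] = 0"
  shows "section_part E P = 0"
  using assms subspace_0[OF subspace_fib] covector_zero
  by (auto intro!: ext section_part_eqI)

text \<open>The description in \<open>section_part\<close> denotes a vector for inhomogeneous
  \<open>P\<close> too: only the summand of degree 1 is nonzero on one-element lists, and that
  summand is represented by a vector.\<close>

lemma
  assumes "P \<in> ext_sections_all E"
  shows section_part_in_fib: "section_part E P x \<in> fib E x"
    and covector_section_part: "\<alpha> \<in> covectors E x \<Longrightarrow> \<alpha> (section_part E P x) = P x [\<alpha>]"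
proof -
  obtain p N where P: "P = (\<Sum>n\<le>N. p n)" and p: "\<And>n. p n \<in> ext_sections E n"
    using assms by (auto simp: ext_sections_all_def)
  \<comment> \<open>For \<open>N = 0\<close> the sum has no summand of degree 1.\<close>
  define T where "T = (if 1 \<le> N then p 1 x else 0)"
  have eq: "P x [\<alpha>] = T [\<alpha>]" for \<alpha>
  proof -
    have "P x [\<alpha>] = (\<Sum>n\<le>N. p n x [\<alpha>])"
      by (simp add: P sum_apply2)
    also have "\<dots> = (\<Sum>n\<le>N. if n = 1 then p 1 x [\<alpha>] else 0)"
      using ext_sections_eq_zero[OF p] by (intro sum.cong) auto
    finally show ?thesis by (simp add: T_def)
  qed
  have "T \<in> ext_power E 1 x"
    using p[of 1] zero_in_ext_sections[of E 1] by (auto simp: T_def ext_sections_def)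
  then obtain v where v: "v \<in> fib E x" "\<And>\<alpha>. \<alpha> \<in> covectors E x \<Longrightarrow> \<alpha> v = P x [\<alpha>]"
    using ext_power_1_represented eq by metis
  with section_part_eqI[of v x P] show "section_part E P x \<in> fib E x"
    and "\<alpha> \<in> covectors E x \<Longrightarrow> \<alpha> (section_part E P x) = P x [\<alpha>]"
    by auto
qed

lemma section_part_lincomb:
  assumes "P \<in> ext_sections_all E" "Q \<in> ext_sections_all E"
  shows "section_part E (\<lambda>x as. c * P x as + Q x as) = (\<lambda>x. c *\<^sub>R section_part E P x + section_part E Q x)"
  using section_part_in_fib assms
  by (intro ext section_part_eqI) (auto simp: fib_lincomb covector_lincomb covector_section_part)

text \<open>The coordinates of the section part are the values of \<open>P\<close> on the coordinate
  covectors, whose smoothness is built into \<open>ext_sections\<close>. The two functions agree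
  only over \<open>U\<close>, hence the appeal to \<open>smooth_on_cong\<close>.\<close>

lemma section_part_in_sections:
  assumes P: "P \<in> ext_sections E 1"
  shows "section_part E P \<in> sections E"
proof -
  note all = ext_sections_imp_all[OF P]
  have "smooth_on E U (\<lambda>x. \<psi> x (section_part E P x) i)"
    if triv: "(U, \<psi>) \<in> trivs E" and i: "i < fib_dim E" for U \<psi> i
  proof -
    have "smooth_on E U (\<lambda>x. P x (map (coord_covector E \<psi> x) [i]))"
      using P triv i unfolding ext_sections_def
      by (auto dest!: bspec[of _ _ "(U, \<psi>)"] spec[of _ "[i]"])
    moreover have "\<psi> x (section_part E P x) i = P x (map (coord_covector E \<psi> x) [i])"
      if "x \<in> U" for x
      using covector_section_part[OF all coord_covector_in_covectors[OF triv that, of i]]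
        section_part_in_fib[OF all, of x]
      by (simp add: coord_covector_def)
    ultimately show ?thesis
      using smooth_on_cong[OF smooth_manifold triv_open[OF triv]] by fastforce
  qed
  then show ?thesis
    using section_part_in_fib[OF all] by (auto simp: sections_def)
qed

lemma
  shows pairing_commute:
      "e \<in> sections E \<Longrightarrow> e' \<in> sections E \<Longrightarrow> pairing E e e' = pairing E e' e"
    and pairing_zero_left: "e \<in> sections E \<Longrightarrow> pairing E 0 e = 0"
    and pairing_zero_right: "e \<in> sections E \<Longrightarrow> pairing E e 0 = 0"
proof -
  have sym: "form E x u v = form E x v u" if "u \<in> fib E x" "v \<in> fib E x" for x u v
    using metric_bundle that by (auto simp: metric_bundle_def)
  have lin: "form E x (c *\<^sub>R u + v) w = c * form E x u w + form E x v w"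
    if "u \<in> fib E x" "v \<in> fib E x" "w \<in> fib E x" for x u v w c
    using metric_bundle that by (auto simp: metric_bundle_def)
  have fib: "s x \<in> fib E x" if "s \<in> sections E" for s x
    using that by (auto simp: sections_def)
  have zero: "form E x 0 w = 0" if "w \<in> fib E x" for x w
    using lin[of 0 x 0 w 1] subspace_0[OF subspace_fib] that by simp
  show "pairing E e e' = pairing E e' e" if "e \<in> sections E" "e' \<in> sections E"
    unfolding pairing_def using sym fib that by auto
  show "pairing E 0 e = 0" if "e \<in> sections E"
    using zero fib[OF that] by (auto simp: pairing_def)
  show "pairing E e 0 = 0" if "e \<in> sections E"
    using zero sym[OF fib[OF that] subspace_0[OF subspace_fib]] fib[OF that]
    by (auto simp: pairing_def)
qed

lemma ext_of_section_in_ext_sections: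
  assumes e: "e \<in> sections E"
  shows "\<epsilon> e \<in> ext_sections E 1"
proof -
  have "\<epsilon> e x \<in> ext_power E 1 x" for x
    unfolding ext_power_def
  proof (intro CollectI conjI allI impI)
    fix us vs a b c assume ab: "set us \<union> set vs \<union> {a, b} \<subseteq> covectors E x"
    then have "(\<lambda>v. c * a v + b v) \<in> covectors E x"
      by (auto simp: covectors_def algebra_simps)
    with ab show "\<epsilon> e x (us @ [\<lambda>v. c * a v + b v] @ vs) = c * \<epsilon> e x (us @ [a] @ vs) + \<epsilon> e x (us @ [b] @ vs)"
      by (auto simp: ext_of_section_def)
  next
    fix as :: "('v \<Rightarrow> real) list" assume "\<not> distinct as"
    then have "length as \<noteq> 1" by (cases as) auto
    then show "\<epsilon> e x as = 0" by (simp add: ext_of_section_def)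
  qed (auto simp: ext_of_section_def)
  moreover have "smooth_on E U (\<lambda>x. \<epsilon> e x (map (coord_covector E \<psi> x) is))"
    if triv: "(U, \<psi>) \<in> trivs E" and "is": "length is = 1" "set is \<subseteq> {..<fib_dim E}" for U \<psi> "is"
  proof -
    obtain i where i: "is = [i]" "i < fib_dim E"
      using "is" by (cases "is") auto
    have "smooth_on E U (\<lambda>x. \<psi> x (e x) i)"
      using e triv i unfolding sections_def by auto
    moreover have "\<psi> x (e x) i = \<epsilon> e x (map (coord_covector E \<psi> x) is)" if "x \<in> U" for x
      using coord_covector_in_covectors[OF triv that] e
      by (auto simp: i ext_of_section_def coord_covector_def sections_def)
    ultimately show ?thesis
      using smooth_on_cong[OF smooth_manifold triv_open[OF triv]] by fastforce
  qed
  ultimately show ?thesis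
    by (auto simp: ext_sections_def)
qed

lemmas ext_of_section_in_all = ext_sections_imp_all[OF ext_of_section_in_ext_sections]

lemma ext_of_section_section_part:
  assumes P: "P \<in> ext_sections E 1"
  shows "\<epsilon> (section_part E P) = P"
proof (intro ext)
  fix x as
  show "\<epsilon> (section_part E P) x as = P x as"
  proof (cases "length as = 1 \<and> set as \<subseteq> covectors E x")
    case True
    then show ?thesis
      using covector_section_part[OF ext_sections_imp_all[OF P]]
      by (auto simp: ext_of_section_def length_Suc_conv)
  next
    case False
    then have "P x as = 0"
      using P unfolding ext_sections_def ext_power_def by blast
    with False show ?thesis unfolding ext_of_section_def by (simp only: if_False)
  qed
qed

lemma ext_of_section_lincomb:
  assumes "a \<in> sections E" "b \<in> sections E"
  shows "\<epsilon> (\<lambda>x. c *\<^sub>R a x + b x) = (\<lambda>x as. c * \<epsilon> a x as + \<epsilon> b x as)"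
proof (intro ext)
  fix x as
  show "\<epsilon> (\<lambda>x. c *\<^sub>R a x + b x) x as = c * \<epsilon> a x as + \<epsilon> b x as"
  proof (cases "length as = 1 \<and> set as \<subseteq> covectors E x")
    case True
    then have "hd as \<in> covectors E x" by (cases as) auto
    with True show ?thesis
      using assms by (simp add: ext_of_section_def covector_lincomb sections_def)
  next
    case False
    then show ?thesis by (auto simp: ext_of_section_def)
  qed
qed

section \<open>The characteristic properties of the extended form\<close>

lemma form_lincomb_left:
  "P \<in> ext_sections_all E \<Longrightarrow> Q \<in> ext_sections_all E \<Longrightarrow> R \<in> ext_sections_all E \<Longrightarrow>
    B (\<lambda>x as. c * P x as + Q x as) R = (\<lambda>x as. c * B P R x as + B Q R x as)"
  and form_lincomb_right:
  "P \<in> ext_sections_all E \<Longrightarrow> Q \<in> ext_sections_all E \<Longrightarrow> R \<in> ext_sections_all E \<Longrightarrow>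
    B R (\<lambda>x as. c * P x as + Q x as) = (\<lambda>x as. c * B R P x as + B R Q x as)"
  using extended_form[unfolded extended_form_def, THEN conjunct1] by blast+

lemma form_in_ext_sections:
  "p \<ge> 1 \<Longrightarrow> q \<ge> 1 \<Longrightarrow> P \<in> ext_sections E p \<Longrightarrow> Q \<in> ext_sections E q \<Longrightarrow>
    B P Q \<in> ext_sections E (p + q - 2)"
  using extended_form[unfolded extended_form_def, THEN conjunct2, THEN conjunct1] by blast

lemma form_sections:
  "e \<in> sections E \<Longrightarrow> e' \<in> sections E \<Longrightarrow> B (\<epsilon> e) (\<epsilon> e') = ext_of_fun (pairing E e e')"
  using extended_form[unfolded extended_form_def, THEN conjunct2, THEN conjunct2, THEN conjunct1]
  by blast

lemma form_graded_sym:
  "P \<in> ext_sections E p \<Longrightarrow> Q \<in> ext_sections E q \<Longrightarrow> B P Q = - parity_sign (p * q) (B Q P)"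
  using extended_form[unfolded extended_form_def, THEN conjunct2, THEN conjunct2, THEN conjunct2,
      THEN conjunct1]
  by blast

lemma form_fun_left: "F \<in> ext_sections E 0 \<Longrightarrow> R \<in> ext_sections_all E \<Longrightarrow> B F R = 0"
  and form_fun_right: "F \<in> ext_sections E 0 \<Longrightarrow> R \<in> ext_sections_all E \<Longrightarrow> B R F = 0"
  using extended_form[unfolded extended_form_def, THEN conjunct2, THEN conjunct2, THEN conjunct2,
      THEN conjunct2, THEN conjunct1]
  by blast+

lemma form_jacobi:
  "P \<in> ext_sections E p \<Longrightarrow> Q \<in> ext_sections E q \<Longrightarrow> R \<in> ext_sections_all E \<Longrightarrow>
    B P (B Q R) = B (B P Q) R + parity_sign (p * q) (B Q (B P R))"
  using extended_form[unfolded extended_form_def, THEN conjunct2, THEN conjunct2, THEN conjunct2,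
      THEN conjunct2, THEN conjunct2, THEN conjunct1]
  by blast

lemma form_add_left:
  assumes "P \<in> ext_sections_all E" "Q \<in> ext_sections_all E" "R \<in> ext_sections_all E"
  shows "B (P + Q) R = B P R + B Q R"
  using form_lincomb_left[OF assms, of 1] by (simp add: plus_fun_def)

lemma form_add_right:
  assumes "P \<in> ext_sections_all E" "Q \<in> ext_sections_all E" "R \<in> ext_sections_all E"
  shows "B R (P + Q) = B R P + B R Q"
  using form_lincomb_right[OF assms, of 1] by (simp add: plus_fun_def)

lemma parity_sign_in_all:
  assumes "P \<in> ext_sections_all E"
  shows "parity_sign n P \<in> ext_sections_all E"
proof -
  obtain p N where P: "P = (\<Sum>n\<le>N. p n)" and p: "\<And>n. p n \<in> ext_sections E n"
    using assms by (auto simp: ext_sections_all_def)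
  have "- p n \<in> ext_sections E n" for n
    using ext_sections_lincomb[OF p zero_in_ext_sections, of "- 1" n] by (simp add: fun_Compl_def)
  then have "(\<Sum>n\<le>N. - p n) \<in> ext_sections_all E"
    by (intro ext_sections_all_sum ext_sections_imp_all)
  then show ?thesis
    using assms by (simp add: parity_sign_def P sum_negf)
qed

lemma form_zero_left: "R \<in> ext_sections_all E \<Longrightarrow> B 0 R = 0"
  and form_zero_right: "R \<in> ext_sections_all E \<Longrightarrow> B R 0 = 0"
  using form_fun_left form_fun_right zero_in_ext_sections by blast+

lemma form_sum_left:
  "(\<And>i. i \<in> I \<Longrightarrow> f i \<in> ext_sections_all E) \<Longrightarrow> R \<in> ext_sections_all E \<Longrightarrow>
    B (\<Sum>i\<in>I. f i) R = (\<Sum>i\<in>I. B (f i) R)"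
  by (induction I rule: infinite_finite_induct)
    (auto simp: form_zero_left form_add_left ext_sections_all_sum)

lemma form_sum_right:
  "(\<And>i. i \<in> I \<Longrightarrow> f i \<in> ext_sections_all E) \<Longrightarrow> R \<in> ext_sections_all E \<Longrightarrow>
    B R (\<Sum>i\<in>I. f i) = (\<Sum>i\<in>I. B R (f i))"
  by (induction I rule: infinite_finite_induct)
    (auto simp: form_zero_right form_add_right ext_sections_all_sum)

lemma form_in_all:
  assumes P: "P \<in> ext_sections_all E" and Q: "Q \<in> ext_sections_all E"
  shows "B P Q \<in> ext_sections_all E"
proof -
  \<comment> \<open>The degree clause of \<open>extended_form\<close> concerns degrees at least 1.
    In degree 0 the form vanishes, which also avoids the truncated subtraction in
    \<open>p + q - 2\<close>.\<close>
  have hom: "B R S \<in> ext_sections_all E" if "R \<in> ext_sections E n" "S \<in> ext_sections E m" for R S n m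
  proof (cases "n = 0 \<or> m = 0")
    case True
    then have "B R S = 0"
      using that form_fun_left form_fun_right ext_sections_imp_all by blast
    then show ?thesis
      using ext_sections_imp_all[OF zero_in_ext_sections] by simp
  next
    case False
    then show ?thesis
      using form_in_ext_sections[of n m R S] that ext_sections_imp_all by fastforce
  qed
  obtain p N where P': "P = (\<Sum>n\<le>N. p n)" and p: "\<And>n. p n \<in> ext_sections E n"
    using P by (auto simp: ext_sections_all_def)
  obtain q M where Q': "Q = (\<Sum>n\<le>M. q n)" and q: "\<And>n. q n \<in> ext_sections E n"
    using Q by (auto simp: ext_sections_all_def)
  have "B P Q = (\<Sum>n\<le>N. B (p n) Q)"
    unfolding P' using ext_sections_imp_all[OF p] Q by (rule form_sum_left)
  also have "\<dots> = (\<Sum>n\<le>N. \<Sum>m\<le>M. B (p n) (q m))"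
    unfolding Q' using ext_sections_imp_all[OF p] ext_sections_imp_all[OF q]
    by (simp add: form_sum_right)
  also have "\<dots> \<in> ext_sections_all E"
    using hom[OF p q] by (intro ext_sections_all_sum)
  finally show ?thesis .
qed

section \<open>Iterated contractions by sections\<close>

lemma contraction_in_ext_sections:
  assumes "e \<in> sections E" "P \<in> ext_sections E (Suc k)"
  shows "B (\<epsilon> e) P \<in> ext_sections E k"
  using form_in_ext_sections[of 1 "Suc k" "\<epsilon> e" P] ext_of_section_in_ext_sections assms by simp

lemma contraction_fun:
  assumes "e \<in> sections E" "F \<in> ext_sections E 0"
  shows "B (\<epsilon> e) F = 0"
  using assms form_fun_right ext_of_section_in_all by blast

lemma contraction_in_all:
  "e \<in> sections E \<Longrightarrow> P \<in> ext_sections_all E \<Longrightarrow> B (\<epsilon> e) P \<in> ext_sections_all E"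
  using ext_of_section_in_all by (rule form_in_all)

abbreviation contractions :: "('m \<Rightarrow> 'v) list \<Rightarrow> ('m, 'v) multisection \<Rightarrow> ('m, 'v) multisection" where
  "contractions es \<equiv> fold (\<lambda>e. B (\<epsilon> e)) es"

lemma contractions_in_all:
  "set es \<subseteq> sections E \<Longrightarrow> P \<in> ext_sections_all E \<Longrightarrow> contractions es P \<in> ext_sections_all E"
  by (induction es arbitrary: P) (auto simp: contraction_in_all)

lemma contractions_in_ext_sections:
  "set es \<subseteq> sections E \<Longrightarrow> P \<in> ext_sections E (length es + k) \<Longrightarrow> contractions es P \<in> ext_sections E k"
  by (induction es arbitrary: P) (auto simp: contraction_in_ext_sections)

lemma contractions_zero: "set es \<subseteq> sections E \<Longrightarrow> contractions es 0 = 0"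
  by (induction es) (auto simp: form_zero_right ext_of_section_in_all)

text \<open>After \<open>k\<close> contractions a function is left, and the next contraction kills
  it.\<close>

lemma contractions_eq_zero:
  assumes "set es \<subseteq> sections E" "P \<in> ext_sections E k" "k < length es"
  shows "contractions es P = 0"
proof -
  define us e vs where "us = take k es" and "e = es ! k" and "vs = drop (Suc k) es"
  have es: "es = us @ e # vs"
    unfolding us_def e_def vs_def using assms(3) by (rule id_take_nth_drop)
  have "length us = k"
    using assms(3) by (simp add: us_def)
  moreover have "set us \<subseteq> sections E"
    using assms(1) set_take_subset[of k es] by (auto simp: us_def)
  ultimately have "contractions us P \<in> ext_sections E 0"
    using assms(2) by (intro contractions_in_ext_sections) auto
  then have "B (\<epsilon> e) (contractions us P) = 0"
    using contraction_fun assms(1) es by auto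
  then show ?thesis
    using contractions_zero[of vs] assms(1) by (simp add: es)
qed

lemma contractions_lincomb:
  assumes "set es \<subseteq> sections E" "P \<in> ext_sections_all E" "Q \<in> ext_sections_all E"
  shows "contractions es (\<lambda>x as. c * P x as + Q x as) =
    (\<lambda>x as. c * contractions es P x as + contractions es Q x as)"
  using assms
  by (induction es arbitrary: P Q) (auto simp: form_lincomb_right ext_of_section_in_all contraction_in_all)

lemma contractions_anticommute:
  assumes "a \<in> sections E" "b \<in> sections E" "R \<in> ext_sections_all E"
  shows "B (\<epsilon> a) (B (\<epsilon> b) R) = - B (\<epsilon> b) (B (\<epsilon> a) R)"
proof -
  note \<epsilon> = ext_of_section_in_ext_sections
  have "B (B (\<epsilon> a) (\<epsilon> b)) R = 0"
    using assms by (intro form_fun_left contraction_in_ext_sections) (use \<epsilon> in auto)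
  then show ?thesis
    using form_jacobi[OF \<epsilon>[OF assms(1)] \<epsilon>[OF assms(2)] assms(3)]
    by (simp add: parity_sign_def)
qed

section \<open>Multisections as cochains\<close>

lemma as_cochain_lincomb:
  assumes "P \<in> ext_sections_all E" "Q \<in> ext_sections_all E"
  shows "\<iota> (\<lambda>x as. c * P x as + Q x as) =
    (\<lambda>x. c * fst (\<iota> P) x + fst (\<iota> Q) x, \<lambda>es x. c *\<^sub>R snd (\<iota> P) es x + snd (\<iota> Q) es x)"
  using assms
  by (auto simp: as_cochain_def contractions_lincomb section_part_lincomb contractions_in_all fun_eq_iff)

lemma as_cochain_add:
  assumes "P \<in> ext_sections_all E" "Q \<in> ext_sections_all E"
  shows "\<iota> (P + Q) = \<iota> P + \<iota> Q"
  using as_cochain_lincomb[OF assms, of 1]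
  by (auto simp: plus_fun_def plus_prod_def)

lemma as_cochain_zero: "\<iota> 0 = 0"
proof (rule prod_eqI)
  have "snd (\<iota> 0) es = 0" for es
    using contractions_zero[of es] section_part_zero_if[of 0] by (simp add: as_cochain_def)
  then show "snd (\<iota> 0) = snd 0" by (simp add: fun_eq_iff)
qed (auto simp: as_cochain_def)

lemma as_cochain_minus:
  assumes "P \<in> ext_sections_all E"
  shows "\<iota> (- P) = - \<iota> P"
  using as_cochain_lincomb[OF assms ext_sections_imp_all[OF zero_in_ext_sections], of "- 1"]
  by (auto simp: as_cochain_zero fun_Compl_def uminus_prod_def)

lemma as_cochain_parity_sign:
  assumes "P \<in> ext_sections_all E"
  shows "\<iota> (parity_sign n P) = parity_sign n (\<iota> P)"
  using as_cochain_minus[OF assms] by (auto simp: parity_sign_def)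

lemma as_cochain_sum:
  "(\<And>i. i \<in> I \<Longrightarrow> f i \<in> ext_sections_all E) \<Longrightarrow> \<iota> (\<Sum>i\<in>I. f i) = (\<Sum>i\<in>I. \<iota> (f i))"
  by (induction I rule: infinite_finite_induct)
    (auto simp: as_cochain_zero as_cochain_add ext_sections_all_sum)

lemma fst_as_cochain:
  assumes "P \<in> ext_sections E (Suc k)"
  shows "fst (\<iota> P) = 0"
  using ext_sections_eq_zero[OF assms] by (auto simp: as_cochain_def zero_fun_def)

lemma snd_as_cochain:
  "set es \<subseteq> sections E \<Longrightarrow> snd (\<iota> P) es = section_part E (contractions es P)"
  by (simp add: as_cochain_def)

text \<open>A list of sections of the wrong length leaves an element of degree other than 1, or
  zero, and \<open>section_part\<close> sees nothing of it.\<close>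

lemma snd_as_cochain_eq_zero:
  assumes P: "P \<in> ext_sections E (Suc k)" and es: "\<not> (length es = k \<and> set es \<subseteq> sections E)"
  shows "snd (\<iota> P) es = 0"
proof (cases "set es \<subseteq> sections E")
  case True
  have "contractions es P x [\<alpha>] = 0" for x \<alpha>
  proof (cases "length es \<le> Suc k")
    case le: True
    then have "contractions es P \<in> ext_sections E (Suc k - length es)"
      using contractions_in_ext_sections[OF True, of P "Suc k - length es"] P by simp
    then show ?thesis
      by (rule ext_sections_eq_zero) (use True es le in auto)
  next
    case False
    then show ?thesis
      using contractions_eq_zero[OF True P] by simp
  qed
  then show ?thesis
    using True by (simp add: snd_as_cochain section_part_zero_if)
qed (simp add: as_cochain_def)

text \<open>On nonempty argument lists this is the first step of the \<open>fold\<close>. The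
  content is in the function component: for \<open>k = 0\<close> it is the form on sections; for
  larger \<open>k\<close> both sides vanish by degree.\<close>

lemma contract_as_cochain:
  assumes e: "e \<in> sections E" and P: "P \<in> ext_sections E (Suc k)"
  shows "contract E e (\<iota> P) = \<iota> (B (\<epsilon> e) P)"
proof -
  have "pairing E e (section_part E P) x = B (\<epsilon> e) P x []" for x
  proof (cases k)
    case 0
    with P have P1: "P \<in> ext_sections E 1" by simp
    have "B (\<epsilon> e) P = ext_of_fun (pairing E e (section_part E P))"
      using form_sections[OF e section_part_in_sections[OF P1]] ext_of_section_section_part[OF P1]
      by simp
    then show ?thesis by (simp add: ext_of_fun_def)
  next
    case (Suc j)
    have "section_part E P = 0"
      using ext_sections_eq_zero[OF P] Suc by (intro section_part_zero_if) simp
    moreover have "B (\<epsilon> e) P x [] = 0"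
      using contraction_in_ext_sections[OF e P] Suc by (intro ext_sections_eq_zero) auto
    ultimately show ?thesis
      using pairing_zero_right[OF e] by simp
  qed
  then show ?thesis
    using e by (auto simp: contract_def as_cochain_def)
qed

text \<open>Pairing a value with \<open>e\<close> amounts to one more contraction, so the symbol
  conditions become statements about iterated contractions.\<close>

lemma pairing_section_part:
  assumes "R \<in> ext_sections E 1" "e \<in> sections E"
  shows "pairing E (section_part E R) e = (\<lambda>x. B (\<epsilon> e) R x [])"
proof -
  note sp = section_part_in_sections[OF assms(1)]
  have "B (\<epsilon> e) R = ext_of_fun (pairing E e (section_part E R))"
    using form_sections[OF assms(2) sp] ext_of_section_section_part[OF assms(1)] by simp
  then show ?thesis
    using pairing_commute[OF sp assms(2)] by (simp add: ext_of_fun_def)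
qed

section \<open>Multisections are pre-multi-Courant structures\<close>

lemma multilinear_as_cochain:
  assumes P: "P \<in> ext_sections E (Suc k)"
  shows "multilinear E k (snd (\<iota> P))"
  unfolding multilinear_def
proof (intro conjI allI impI)
  fix es assume "length es = k \<and> set es \<subseteq> sections E"
  then show "snd (\<iota> P) es \<in> sections E"
    using contractions_in_ext_sections[of es P 1] P
    by (simp add: snd_as_cochain section_part_in_sections)
next
  fix us a b vs c
  assume "length us + length vs + 1 = k \<and> set us \<union> set vs \<union> {a, b} \<subseteq> sections E"
  then have us: "set us \<subseteq> sections E" and vs: "set vs \<subseteq> sections E"
    and ab: "a \<in> sections E" "b \<in> sections E" by auto
  let ?R = "contractions us P"
  let ?c = "\<lambda>x. c *\<^sub>R a x + b x"
  have R: "?R \<in> ext_sections_all E"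
    using contractions_in_all[OF us ext_sections_imp_all[OF P]] .
  note aR = contraction_in_all[OF _ R]
  have c: "?c \<in> sections E"
    using ab by (rule sections_lincomb)
  \<comment> \<open>The varied argument sits on the left of a single \<open>B\<close>; the
    contractions by \<open>vs\<close> are linear in the result.\<close>
  have "contractions vs (B (\<epsilon> ?c) ?R) =
      (\<lambda>x as. c * contractions vs (B (\<epsilon> a) ?R) x as + contractions vs (B (\<epsilon> b) ?R) x as)"
    using ab R vs
    by (simp add: ext_of_section_lincomb form_lincomb_left ext_of_section_in_all contractions_lincomb aR)
  then show "snd (\<iota> P) (us @ [?c] @ vs) =
      (\<lambda>x. c *\<^sub>R snd (\<iota> P) (us @ [a] @ vs) x + snd (\<iota> P) (us @ [b] @ vs) x)"
    using us vs ab c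
    by (simp add: snd_as_cochain section_part_lincomb contractions_in_all aR)
qed (use snd_as_cochain_eq_zero[OF P] in auto)

text \<open>Exchanging neighbouring arguments exchanges two consecutive contractions, and the sign
  passes through the remaining ones.\<close>

lemma as_cochain_skew:
  assumes P: "P \<in> ext_sections_all E" and "set us \<subseteq> sections E" "set vs \<subseteq> sections E"
    and ab: "a \<in> sections E" "b \<in> sections E"
  shows "snd (\<iota> P) (us @ [a, b] @ vs) + snd (\<iota> P) (us @ [b, a] @ vs) = 0"
proof -
  let ?R = "B (\<epsilon> b) (B (\<epsilon> a) (contractions us P))"
  have R: "?R \<in> ext_sections_all E"
    using assms by (intro contraction_in_all contractions_in_all)
  have "snd (\<iota> P) (us @ [a, b] @ vs) = snd (\<iota> ?R) vs"
    using assms by (simp add: snd_as_cochain)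
  moreover have "snd (\<iota> P) (us @ [b, a] @ vs) = snd (\<iota> (- ?R)) vs"
    using assms contractions_anticommute[OF ab contractions_in_all[of us P]]
    by (simp add: snd_as_cochain)
  ultimately show ?thesis
    using as_cochain_minus[OF R] by simp
qed

text \<open>With symbol zero, the first identity says that \<open>e\<close> and \<open>e'\<close>
  may be exchanged at the cost of a sign, which is anticommutation of the last two contractions. The
  second is \<open>as_cochain_skew\<close>.\<close>

lemma is_symbol_zero_as_cochain:
  assumes P: "P \<in> ext_sections E (Suc (Suc k))"
  shows "is_symbol E (Suc k) (snd (\<iota> P)) (\<lambda>_ _. 0)"
  unfolding is_symbol_def
proof (intro conjI allI impI)
  show "vector_field E (\<lambda>_. 0)"
    using smooth_on_zero[of E UNIV] by (auto simp: vector_field_def smooth_funs_def zero_fun_def)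
next
  fix es e e'
  assume "length es = Suc k - 1 \<and> set es \<union> {e, e'} \<subseteq> sections E"
  then have len: "length es = k" and es: "set es \<subseteq> sections E"
    and e: "e \<in> sections E" and e': "e' \<in> sections E" by auto
  let ?R = "contractions es P"
  have R: "?R \<in> ext_sections E (Suc 1)"
    using contractions_in_ext_sections[OF es, of P 2] P len by (simp add: numeral_2_eq_2)
  have sp: "section_part E (B (\<epsilon> s) ?R) \<in> sections E" if "s \<in> sections E" for s
    using contraction_in_ext_sections[OF that R] by (rule section_part_in_sections)
  have "pairing E (section_part E (B (\<epsilon> e) ?R)) e' = (\<lambda>x. B (\<epsilon> e') (B (\<epsilon> e) ?R) x [])"
    using contraction_in_ext_sections[OF e R] e' by (rule pairing_section_part)
  also have "\<dots> = - (\<lambda>x. B (\<epsilon> e) (B (\<epsilon> e') ?R) x [])"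
    using contractions_anticommute[OF e' e ext_sections_imp_all[OF R]] by (auto simp: fun_eq_iff)
  also have "(\<lambda>x. B (\<epsilon> e) (B (\<epsilon> e') ?R) x []) = pairing E (section_part E (B (\<epsilon> e') ?R)) e"
    using contraction_in_ext_sections[OF e' R] e by (rule pairing_section_part[symmetric])
  also have "\<dots> = pairing E e (section_part E (B (\<epsilon> e') ?R))"
    using sp[OF e'] e by (rule pairing_commute)
  finally show "0 = pairing E (snd (\<iota> P) (es @ [e])) e' + pairing E e (snd (\<iota> P) (es @ [e']))"
    using es e e' by (simp add: snd_as_cochain fun_eq_iff)
next
  fix us a b vs e
  assume "length us + length vs + 2 = Suc k \<and> set us \<union> set vs \<union> {a, b, e} \<subseteq> sections E"
  then show "pairing E (snd (\<iota> P) (us @ [a, b] @ vs) + snd (\<iota> P) (us @ [b, a] @ vs)) e = 0"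
    using as_cochain_skew[OF ext_sections_imp_all[OF P]] pairing_zero_left by simp
qed

lemma as_cochain_in_cochains:
  assumes P: "P \<in> ext_sections E (Suc (Suc k))"
  shows "\<iota> P \<in> cochains E (Suc (Suc k))"
proof -
  have "pre_courant E (Suc k) (snd (\<iota> P))"
    using multilinear_as_cochain[OF P] is_symbol_zero_as_cochain[OF P] by (auto simp: pre_courant_def)
  moreover have "\<iota> P = (0, snd (\<iota> P))"
    using fst_as_cochain[OF P] by (simp add: prod_eq_iff)
  ultimately show ?thesis
    by (auto simp: cochains_def)
qed

section \<open>The bracket of homogeneous multisections\<close>

text \<open>From degree 2 on the arity is positive, so every admissible argument list has a head to
  contract with; on all other lists both maps are zero by convention.\<close>

lemma cochains_eqI:
  assumes "X \<in> cochains E (Suc (Suc k))" "Y \<in> cochains E (Suc (Suc k))"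
    and contract: "\<And>e. e \<in> sections E \<Longrightarrow> contract E e X = contract E e Y"
  shows "X = Y"
proof -
  obtain C D where X: "X = (0, C)" and Y: "Y = (0, D)"
    and C: "multilinear E (Suc k) C" and D: "multilinear E (Suc k) D"
    using assms(1,2) by (auto simp: cochains_def pre_courant_def)
  have "C es = D es" for es
  proof (cases "length es = Suc k \<and> set es \<subseteq> sections E")
    case True
    then obtain e es' where es: "es = e # es'" by (cases es) auto
    with True have "contract E e X = contract E e Y" by (intro contract) auto
    then show ?thesis
      by (auto simp: contract_def X Y es fun_eq_iff)
  next
    case False
    then have "C es = 0" "D es = 0"
      using C D unfolding multilinear_def by blast+
    then show ?thesis by simp
  qed
  then show ?thesis by (auto simp: X Y)
qed

lemma by_contractions_as_cochain:
  assumes P: "P \<in> ext_sections E (Suc (Suc k))"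
    and G: "\<And>e. e \<in> sections E \<Longrightarrow> G e = \<iota> (B (\<epsilon> e) P)"
  shows "by_contractions E (Suc (Suc k)) G = \<iota> P"
  unfolding by_contractions_def
proof (rule the_equality)
  show "\<iota> P \<in> cochains E (Suc (Suc k)) \<and> (\<forall>e\<in>sections E. contract E e (\<iota> P) = G e)"
    using as_cochain_in_cochains[OF P] contract_as_cochain[OF _ P] G by auto
  show "Z = \<iota> P"
    if "Z \<in> cochains E (Suc (Suc k)) \<and> (\<forall>e\<in>sections E. contract E e Z = G e)" for Z
  proof (rule cochains_eqI)
    show "contract E e Z = contract E e (\<iota> P)" if "e \<in> sections E" for e
      using \<open>Z \<in> _ \<and> _\<close> that contract_as_cochain[OF that P] G[OF that] by auto
  qed (use that as_cochain_in_cochains[OF P] in auto)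
qed

text \<open>Each recursive call lowers one degree by 1 and stops when either degree is 1, so
  starting from positive degrees it ends in contractions by a section. In the recursive case both
  degrees are at least 2, hence so is the degree of the result, as
  \<open>by_contractions_as_cochain\<close> requires.\<close>

lemma KW_hom_as_cochain:
  assumes "P \<in> ext_sections E (Suc p)" "Q \<in> ext_sections E (Suc q)"
  shows "KW_hom E (Suc p) (Suc q) (\<iota> P) (\<iota> Q) = \<iota> (B P Q)"
  using assms
proof (induction "p + q" arbitrary: p q P Q rule: less_induct)
  case less
  note P = less.prems(1) and Q = less.prems(2)
  note P_all = ext_sections_imp_all[OF P] and Q_all = ext_sections_imp_all[OF Q]
  have snd_Nil: "snd (\<iota> R) [] = section_part E R" for R
    by (simp add: as_cochain_def)
  \<comment> \<open>A multisection of degree 1 comes from its section part, so bracketing with it is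
    contraction by that section.\<close>
  have degree_1: "contract E (snd (\<iota> R) []) (\<iota> S) = \<iota> (B R S)"
    if R: "R \<in> ext_sections E (Suc 0)" and S: "S \<in> ext_sections E (Suc k)" for R S k
    using contract_as_cochain[OF section_part_in_sections S] ext_of_section_section_part R
    by (simp add: snd_Nil)
  consider "p = 0" | p' where "p = Suc p'" "q = 0" | p' q' where "p = Suc p'" "q = Suc q'"
    by (metis not0_implies_Suc)
  then show ?case
  proof cases
    case 1
    then show ?thesis
      using degree_1 P Q by simp
  next
    case 2
    with Q have Q1: "Q \<in> ext_sections E (Suc 0)" by simp
    have "B Q P \<in> ext_sections_all E"
      using Q_all P_all by (rule form_in_all)
    \<comment> \<open>Graded symmetry with \<open>Q\<close> of degree 1 gives the sign
      \<open>-(-1)^(p+1)\<close>, where \<open>P\<close> has degree \<open>p + 1\<close>; this is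
      the sign in the definition of \<open>KW_hom\<close>.\<close>
    moreover have "B P Q = parity_sign (Suc p + 1) (B Q P)"
      using form_graded_sym[OF P Q1] by (simp add: parity_sign_def)
    ultimately have "\<iota> (B P Q) = parity_sign (Suc p + 1) (\<iota> (B Q P))"
      by (simp only: as_cochain_parity_sign)
    then show ?thesis
      using degree_1[OF Q1 P] 2 by simp
  next
    case 3
    let ?G = "\<lambda>e. KW_hom E (Suc p') (Suc (Suc q')) (contract E e (\<iota> P)) (\<iota> Q) +
      parity_sign p' (KW_hom E (Suc (Suc p')) (Suc q') (\<iota> P) (contract E e (\<iota> Q)))"
    have PQ: "B P Q \<in> ext_sections E (Suc (Suc (p' + q')))"
      using form_in_ext_sections[OF _ _ P Q] 3 by simp
    have "?G e = \<iota> (B (\<epsilon> e) (B P Q))" if e: "e \<in> sections E" for e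
    proof -
      have eP: "B (\<epsilon> e) P \<in> ext_sections E (Suc p')" and eQ: "B (\<epsilon> e) Q \<in> ext_sections E (Suc q')"
        using contraction_in_ext_sections[OF e] P Q 3 by auto
      have 1: "KW_hom E (Suc p') (Suc (Suc q')) (contract E e (\<iota> P)) (\<iota> Q) = \<iota> (B (B (\<epsilon> e) P) Q)"
        using less.hyps[OF _ eP Q] contract_as_cochain[OF e P] 3 by simp
      have 2: "KW_hom E (Suc (Suc p')) (Suc q') (\<iota> P) (contract E e (\<iota> Q)) = \<iota> (B P (B (\<epsilon> e) Q))"
        using less.hyps[OF _ P eQ] contract_as_cochain[OF e Q] 3 by simp
      have all: "B (B (\<epsilon> e) P) Q \<in> ext_sections_all E" "B P (B (\<epsilon> e) Q) \<in> ext_sections_all E"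
        using P_all Q_all ext_of_section_in_all[OF e] by (auto intro: form_in_all)
      have all': "parity_sign p' (B P (B (\<epsilon> e) Q)) \<in> ext_sections_all E"
        using all(2) by (rule parity_sign_in_all)
      \<comment> \<open>The Jacobi sign is governed by the degree \<open>p' + 2\<close> of
        \<open>P\<close>, which has the parity of \<open>p'\<close>, the exponent in
        \<open>KW_hom\<close>.\<close>
      have "B (\<epsilon> e) (B P Q) = B (B (\<epsilon> e) P) Q + parity_sign p' (B P (B (\<epsilon> e) Q))"
        using form_jacobi[OF ext_of_section_in_ext_sections[OF e] P Q_all] 3
        by (simp add: parity_sign_def)
      then show ?thesis
        using as_cochain_add[OF all(1) all'] as_cochain_parity_sign[OF all(2)] 1 2 by simp
    qed
    then have "by_contractions E (Suc (Suc (p' + q'))) ?G = \<iota> (B P Q)"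
      by (rule by_contractions_as_cochain[OF PQ])
    then show ?thesis
      using 3 by simp
  qed
qed

section \<open>Extension to the direct sum\<close>

lemma ext_sections_ge1E:
  assumes "P \<in> ext_sections_ge1 E"
  obtains p N where "P = (\<Sum>n\<le>N. p n)" "\<And>n. p n \<in> ext_sections E n" "p 0 = 0"
proof -
  obtain p N where P: "P = (\<Sum>n=1..N. p n)" and p: "\<And>n. p n \<in> ext_sections E n"
    using assms by (auto simp: ext_sections_ge1_def)
  show ?thesis
  proof (rule that)
    show "P = (\<Sum>n\<le>N. if n = 0 then 0 else p n)"
      unfolding P by (rule sum.mono_neutral_cong_left) auto
  qed (use p zero_in_ext_sections in auto)
qed

text \<open>The cochain of \<open>p k\<close> is supported on lists of length \<open>k - 1\<close>,
  so restricting to one length picks out one summand.\<close>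

lemma component_as_cochain:
  assumes p: "\<And>n. p n \<in> ext_sections E n" and p0: "p 0 = 0"
  shows "component n (\<iota> (\<Sum>k\<le>N. p k)) = (if n \<le> N then \<iota> (p n) else 0)"
proof (cases n)
  case 0
  have "fst (\<iota> (p k)) = 0" for k
    using fst_as_cochain[of "p k" "k - 1"] p[of k] p0 as_cochain_zero by (cases k) auto
  then have "fst (\<iota> (\<Sum>k\<le>N. p k)) = 0"
    by (simp add: as_cochain_sum[OF ext_sections_imp_all[OF p]] fst_sum)
  with 0 p0 show ?thesis
    by (simp add: component_def as_cochain_zero zero_prod_def)
next
  case (Suc m)
  have other: "snd (\<iota> (p k)) es = 0" if "k \<noteq> Suc (length es)" for k es
  proof (cases k)
    case 0
    then show ?thesis using p0 as_cochain_zero by simp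
  next
    case (Suc j)
    then show ?thesis using snd_as_cochain_eq_zero[of "p k" j es] p[of k] that by auto
  qed
  have "snd (\<iota> (\<Sum>k\<le>N. p k)) es = (\<Sum>k\<le>N. snd (\<iota> (p k)) es)" for es
    by (simp add: as_cochain_sum[OF ext_sections_imp_all[OF p]] snd_sum sum_apply1)
  also have "(\<Sum>k\<le>N. snd (\<iota> (p k)) es) =
      (\<Sum>k\<le>N. if k = Suc (length es) then snd (\<iota> (p (Suc (length es)))) es else 0)" for es
    using other by (intro sum.cong) auto
  finally have eq: "snd (\<iota> (\<Sum>k\<le>N. p k)) es =
      (if Suc (length es) \<le> N then snd (\<iota> (p (Suc (length es)))) es else 0)" for es
    by simp
  have "snd (component n (\<iota> (\<Sum>k\<le>N. p k))) es = snd (if n \<le> N then \<iota> (p n) else 0) es" for es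
    using Suc other[of n es] by (simp add: component_def eq)
  moreover have "fst (component n (\<iota> (\<Sum>k\<le>N. p k))) = fst (if n \<le> N then \<iota> (p n) else 0)"
    using Suc fst_as_cochain[of "p n" m] p[of n] by (simp add: component_def)
  ultimately show ?thesis
    by (intro prod_eqI) auto
qed

text \<open>\<open>KW_hom_as_cochain\<close> expresses the left-hand side through
  \<open>\<iota> P\<close> and \<open>\<iota> Q\<close> alone, so an argument with vanishing cochain
  may be replaced by 0. This stands in for injectivity of \<open>\<iota>\<close>.\<close>

lemma as_cochain_form_eq_zero:
  assumes P: "P \<in> ext_sections E p" and Q: "Q \<in> ext_sections E q"
    and zero: "\<iota> P = 0 \<or> \<iota> Q = 0"
  shows "\<iota> (B P Q) = 0"
proof (cases "p = 0 \<or> q = 0")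
  case True
  then show ?thesis
    using P Q form_fun_left form_fun_right ext_sections_imp_all as_cochain_zero by metis
next
  case False
  then obtain p' q' where pq: "p = Suc p'" "q = Suc q'"
    by (metis not0_implies_Suc)
  note KW = KW_hom_as_cochain[of _ p' _ q'] and zero_all = zero_in_ext_sections[of E]
  note P_all = ext_sections_imp_all[OF P] and Q_all = ext_sections_imp_all[OF Q]
  from zero show ?thesis
  proof
    assume "\<iota> P = 0"
    then have "\<iota> (B P Q) = \<iota> (B 0 Q)"
      using KW[of P Q] KW[of 0 Q] P Q zero_all pq as_cochain_zero by simp
    then show ?thesis using form_zero_left[OF Q_all] as_cochain_zero by simp
  next
    assume "\<iota> Q = 0"
    then have "\<iota> (B P Q) = \<iota> (B P 0)"
      using KW[of P Q] KW[of P 0] P Q zero_all pq as_cochain_zero by simp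
    then show ?thesis using form_zero_right[OF P_all] as_cochain_zero by simp
  qed
qed

lemma as_cochain_form:
  assumes P: "P \<in> ext_sections_ge1 E" and Q: "Q \<in> ext_sections_ge1 E"
  shows "\<iota> (B P Q) = KW_bracket E (\<iota> P) (\<iota> Q)"
proof -
  obtain p N where P: "P = (\<Sum>n\<le>N. p n)" and p: "\<And>n. p n \<in> ext_sections E n" "p 0 = 0"
    using ext_sections_ge1E[OF P] by blast
  obtain q M where Q: "Q = (\<Sum>n\<le>M. q n)" and q: "\<And>n. q n \<in> ext_sections E n" "q 0 = 0"
    using ext_sections_ge1E[OF Q] by blast
  note p_all = ext_sections_imp_all[OF p(1)] and q_all = ext_sections_imp_all[OF q(1)]
  have "B P Q = (\<Sum>n\<le>N. B (p n) Q)"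
    unfolding P Q using p_all q_all by (intro form_sum_left ext_sections_all_sum)
  also have "\<dots> = (\<Sum>n\<le>N. \<Sum>m\<le>M. B (p n) (q m))"
    unfolding Q using p_all q_all by (simp add: form_sum_right)
  finally have "\<iota> (B P Q) = (\<Sum>n\<le>N. \<Sum>m\<le>M. \<iota> (B (p n) (q m)))"
    using p_all q_all by (simp add: as_cochain_sum ext_sections_all_sum form_in_all)
  moreover have "KW_bracket E (\<iota> P) (\<iota> Q) = (\<Sum>n\<le>N. \<Sum>m\<le>M. \<iota> (B (p n) (q m)))"
    unfolding KW_bracket_def
  \<comment> \<open>The sums in \<open>KW_bracket\<close> range over the nonzero components; the
    degrees missing from \<open>{..N}\<close> and \<open>{..M}\<close> contribute zero by the
    previous lemma.\<close>
  proof (intro sum.mono_neutral_cong_left ballI sum.neutral)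
    note comp = component_as_cochain[OF p, of _ N, folded P] component_as_cochain[OF q, of _ M, folded Q]
    show "{n. component n (\<iota> P) \<noteq> 0} \<subseteq> {..N}" "{m. component m (\<iota> Q) \<noteq> 0} \<subseteq> {..M}"
      by (auto simp: comp split: if_splits)
    show "\<iota> (B (p n) (q m)) = 0" if "n \<in> {..N} - {n. component n (\<iota> P) \<noteq> 0}" for n m
      using that by (intro as_cochain_form_eq_zero[OF p(1) q(1)]) (auto simp: comp)
    show "\<iota> (B (p n) (q m)) = 0" if "m \<in> {..M} - {m. component m (\<iota> Q) \<noteq> 0}" for n m
      using that by (intro as_cochain_form_eq_zero[OF p(1) q(1)]) (auto simp: comp)
    show "KW_hom E n m (component n (\<iota> P)) (component m (\<iota> Q)) = \<iota> (B (p n) (q m))"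
      if "n \<in> {n. component n (\<iota> P) \<noteq> 0}" "m \<in> {m. component m (\<iota> Q) \<noteq> 0}" for n m
    proof -
      \<comment> \<open>Degree 0 is excluded since \<open>p 0\<close> and \<open>q 0\<close> are
        zero, so \<open>n - 1\<close> and \<open>m - 1\<close> below are true predecessors.\<close>
      have "n \<le> N" "m \<le> M" "n \<noteq> 0" "m \<noteq> 0"
        using that p(2) q(2) as_cochain_zero by (auto simp: comp split: if_splits intro!: gr0I)
      then show ?thesis
        using KW_hom_as_cochain[of "p n" "n - 1" "q m" "m - 1"] p(1)[of n] q(1)[of m]
        by (simp add: comp)
    qed
  qed auto
  ultimately show ?thesis by simp
qed

end

theorem lemma4p2:
  fixes E :: "('m::{t2_space, second_countable_topology}, 'v::real_vector) vbundle"
    and B :: "('m, 'v) multisection \<Rightarrow> ('m, 'v) multisection \<Rightarrow> ('m, 'v) multisection"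
  assumes "metric_bundle E"
    and "extended_form E B"
    and "P \<in> ext_sections_ge1 E"
    and "Q \<in> ext_sections_ge1 E"
  shows "as_cochain E B (B P Q) = KW_bracket E (as_cochain E B P) (as_cochain E B Q)"
proof -
  interpret metric_bundle_form E B
    using assms(1,2) by unfold_locales
  show ?thesis
    using assms(3,4) by (rule as_cochain_form)
qed

end
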